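(* Let $1<p<\infty$. There is a constant $C_p<\infty$ depending only on $p$ such that for every $\tau\in(0,\frac12)$ and every $\Gamma>1$ there exist $\tau$-doubling measures $\sigma$ and $\omega$ on $\mathbb{R}$ such that $$A_p(\sigma,\omega)\le C_p\qquad\text{and yet}\qquad \mathfrak{N}_{\mathcal{M}^{\mathcal{D}([0,1))},p}(\sigma,\omega)>\Gamma .$$
   Context: For a locally finite positive Borel measure $\mu$ on $\mathbb{R}$ write $|J|_\mu=\mu(J)$; $|J|$ is Lebesgue measure. $\mu$ is $\tau$-doubling on $\mathbb{R}$ if for every bounded interval $J$ with left and right halves $J_-,J_+$ one has $|J_-|_\mu\le(1+\tau)|J_+|_\mu$ and $|J_+|_\mu\le(1+\tau)|J_-|_\mu$. $A_p(\sigma,\omega)=\sup_I\big(\frac{|I|_\sigma}{|I|}\big)^{1/p'}\big(\frac{|I|_\omega}{|I|}\big)^{1/p}$, supremum over all bounded intervals $I$, $\frac1p+\frac1{p'}=1$. $\mathcal{D}([0,1))$ is the set of all dyadic subintervals $[j2^{-k},(j+1)2^{-k})$, $k\ge0$, $0\le j<2^k$, of $[0,1)$. Let $\mathcal{M}_\sigma^{\mathcal{D}([0,1))}f(x)=\sup_{J\in\mathcal{D}([0,1)):\,x\in J}\frac1{|J|}\int_J|f|\,d\sigma$ (and $0$ if no such $J$ exists). $\mathfrak{N}_{\mathcal{M}^{\mathcal{D}([0,1))},p}(\sigma,\omega)\in[0,\infty]$ is the best constant $C$ in $\|\mathcal{M}^{\mathcal{D}([0,1))}_\sigma f\|_{L^p(\omega)}\le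 C\|f\|_{L^p(\sigma)}$ for all $f\in L^p(\sigma)$. *)

theory Defs
  imports "HOL-Analysis.Analysis"
begin

definition locally_finite_borel :: "real measure \<Rightarrow> bool" where
  "locally_finite_borel \<mu> \<longleftrightarrow>
     sets \<mu> = sets borel \<and> (\<forall>x. \<exists>U. open U \<and> x \<in> U \<and> emeasure \<mu> U < \<infinity>)"

(* Open, closed and half-open intervals are all included; the empty set and
   single points, which have length 0, are not. *)
definition bounded_intervals :: "real set set" where
  "bounded_intervals = {J. is_interval J \<and> bounded J \<and> interior J \<noteq> {}}"

definition midpt :: "real set \<Rightarrow> real" where
  "midpt J = (Inf J + Sup J) / 2"

(* The midpoint is assigned to the right half, as for half-open intervals [a, b).
   The choice is immaterial: doubling measures have no atoms. *)
definition left_half :: "real set \<Rightarrow> real set" where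
  "left_half J = {x \<in> J. x < midpt J}"

definition right_half :: "real set \<Rightarrow> real set" where
  "right_half J = {x \<in> J. midpt J \<le> x}"

definition doubling :: "real \<Rightarrow> real measure \<Rightarrow> bool" where
  "doubling \<tau> \<mu> \<longleftrightarrow>
     (\<forall>J\<in>bounded_intervals.
        emeasure \<mu> (left_half J) \<le> ennreal (1 + \<tau>) * emeasure \<mu> (right_half J) \<and>
        emeasure \<mu> (right_half J) \<le> ennreal (1 + \<tau>) * emeasure \<mu> (left_half J))"

(* x to the power r on [0, \<infinity>], used only for exponents r > 0. *)
definition enn_powr :: "ennreal \<Rightarrow> real \<Rightarrow> ennreal" where
  "enn_powr x r = (if x = \<infinity> then \<infinity> else ennreal (enn2real x powr r))"

definition conj_exponent :: "real \<Rightarrow> real" where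
  "conj_exponent p = p / (p - 1)"

definition Ap_const :: "real \<Rightarrow> real measure \<Rightarrow> real measure \<Rightarrow> ennreal" where
  "Ap_const p \<sigma> \<omega> =
     (SUP I\<in>bounded_intervals.
        enn_powr (emeasure \<sigma> I / emeasure lborel I) (1 / conj_exponent p) *
        enn_powr (emeasure \<omega> I / emeasure lborel I) (1 / p))"

definition dyadic_unit :: "real set set" where
  "dyadic_unit = {{real j / 2 ^ k ..< (real j + 1) / 2 ^ k} | j k :: nat. j < 2 ^ k}"

(* The average divides by the Lebesgue measure of J, not by its \<sigma>-measure. The supremum
   in ennreal over the empty family is 0. *)
definition dyadic_maximal :: "real measure \<Rightarrow> (real \<Rightarrow> real) \<Rightarrow> real \<Rightarrow> ennreal" where
  "dyadic_maximal \<sigma> f x =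
     (SUP J\<in>{J \<in> dyadic_unit. x \<in> J}.
        (\<integral>\<^sup>+ y\<in>J. ennreal \<bar>f y\<bar> \<partial>\<sigma>) / emeasure lborel J)"

(* The L^p norm of a function with values in [0, \<infinity>]. *)
definition Lp_enorm :: "real \<Rightarrow> real measure \<Rightarrow> (real \<Rightarrow> ennreal) \<Rightarrow> ennreal" where
  "Lp_enorm p \<mu> g = enn_powr (\<integral>\<^sup>+ x. enn_powr (g x) p \<partial>\<mu>) (1 / p)"

definition Lp_space :: "real \<Rightarrow> real measure \<Rightarrow> (real \<Rightarrow> real) set" where
  "Lp_space p \<mu> =
     {f. f \<in> borel_measurable \<mu> \<and> Lp_enorm p \<mu> (\<lambda>x. ennreal \<bar>f x\<bar>) < \<infinity>}"

definition maximal_norm :: "real \<Rightarrow> real measure \<Rightarrow> real measure \<Rightarrow> ennreal" where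
  "maximal_norm p \<sigma> \<omega> =
     Inf {C. \<forall>f\<in>Lp_space p \<sigma>.
       Lp_enorm p \<omega> (dyadic_maximal \<sigma> f) \<le> C * Lp_enorm p \<sigma> (\<lambda>x. ennreal \<bar>f x\<bar>)}"

end

theory Submission
  imports Defs
begin

text \<open>
  The example comes from the failure of the martingale maximal inequality in \<open>L\<^sup>1\<close>. Let \<open>S\<close> be a
  positive martingale that starts at \<open>1\<close> and is multiplied in each step by an independent factor
  within \<open>\<delta>\<close> of \<open>1\<close>, and let \<open>M\<close> be its running maximum. Put \<open>\<sigma> = S dx\<close> and
  \<open>\<omega> = M powr (1 - p) dx\<close>, both taken after \<open>n\<close> steps. Given the first
  \<open>m\<close> steps, \<open>\<sigma>\<close> has conditional average \<open>S\<close> and that of \<open>\<omega>\<close> is at most \<open>S powr (1 - p)\<close>, as \<open>M\<close> only increases; so the two-weight condition holds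
  with a bounded constant whatever \<open>n\<close> is (\<open>Ap_cascade_measure\<close>). On the other hand the maximal
  function of \<open>1\<close> is at least \<open>M\<close>, and the integral of \<open>M powr p\<close> against \<open>\<omega>\<close> is the expectation of
  \<open>M\<close> (\<open>maximal_norm_lower_bound\<close>). That expectation tends to infinity with \<open>n\<close>: the entropy
  of \<open>S\<close> grows linearly in \<open>n\<close>, and a maximum that is reached in small relative steps is bounded below
  by the entropy (\<open>expect_max_ge\<close>).

  Both measures must be doubling for all intervals, not only for dyadic ones. The walk is therefore
  written into the digits of \<open>x\<close> to a large base \<open>R\<close>, a digit \<open>d\<close> contributing the factor
  \<open>1 + \<delta> * cos (2 * pi * d / R)\<close>. Each step is exactly a martingale step on the cells of the
  \<open>R\<close>-adic grid, and the factor changes by only \<open>O(1 / R)\<close> between neighbouring digits, cyclically, so that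
  neighbouring cells carry almost the same state even when many digits change by a carry. An interval
  is compared with the coarsest generation of cells that resolves it (\<open>scale_of_interval\<close>); there the
  state varies by little more than one factor \<open>(1 + \<delta>) / (1 - \<delta>)\<close>, which gives a doubling constant
  close to \<open>1\<close> (\<open>doubling_cascade_measure\<close>). The averages of \<open>\<omega>\<close> need no separate estimates: a
  function of the state that is Lipschitz on a logarithmic scale has conditional expectations with the same
  property (\<open>log_lipschitz_expect\<close>).
\<close>

section \<open>Elementary inequalities and cosine sums\<close>

lemma sum_cos_roots_of_unity:
  fixes k R :: nat
  assumes "0 < k" "k < R"
  shows "(\<Sum>d<R. cos (2 * pi * real k * real d / real R)) = 0"
proof -
  define z where "z = cis (2 * pi * real k / real R)"
  have "z \<noteq> 1"
  proof
    assume "z = 1"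
    then have "cos (2 * pi * real k / real R) = 1"
      by (metis z_def cis.sel(1) one_complex.sel(1))
    then obtain n :: int where "2 * pi * real k / real R = real_of_int n * 2 * pi"
      using cos_one_2pi_int by auto
    then have "real k = of_int n * real R"
      using assms by (simp add: field_simps)
    then have "int k = n * int R"
      by (metis of_int_eq_iff of_int_mult of_int_of_nat_eq)
    then have "int R dvd int k" by simp
    then show False using assms by (simp add: nat_dvd_not_less)
  qed
  moreover have "z ^ R = 1"
  proof -
    have "z ^ R = cis (real R * (2 * pi * real k / real R))" unfolding z_def by (rule Complex.DeMoivre)
    also have "real R * (2 * pi * real k / real R) = 2 * pi * real k" using assms by simp
    also have "cis \<dots> = 1" by (rule cis_multiple_2pi) simp
    finally show ?thesis .
  qed
  ultimately have "(\<Sum>d<R. z ^ d) = 0"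
    by (simp add: geometric_sum)
  then have "Re (\<Sum>d<R. z ^ d) = 0" by simp
  then show ?thesis
    by (simp add: z_def Complex.DeMoivre mult_ac)
qed

lemma abs_cos_diff_le: "\<bar>cos x - cos y\<bar> \<le> \<bar>x - y\<bar>" for x y :: real
proof -
  have "\<bar>cos x - cos y\<bar> = 2 * (\<bar>sin ((x + y) / 2)\<bar> * \<bar>sin ((y - x) / 2)\<bar>)"
    by (simp add: cos_diff_cos abs_mult)
  also have "\<dots> \<le> 2 * (1 * \<bar>(y - x) / 2\<bar>)"
    by (intro mult_left_mono mult_mono) (auto intro: abs_sin_x_le_abs_x simp del: abs_divide)
  finally show ?thesis by (simp add: abs_minus_commute)
qed

text \<open>With \<open>u = sqrt (1 + y)\<close>, the inequality \<open>ln u \<ge> 1 - 1 / u\<close> gives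
\<open>(1 + y) * ln (1 + y) \<ge> 2 * u\<^sup>2 - 2 * u = y + (u - 1)\<^sup>2\<close>, and \<open>u - 1 = y / (u + 1)\<close>.\<close>

lemma entropy_lower_bound:
  fixes y :: real
  assumes "\<bar>y\<bar> \<le> 1 / 2"
  shows "y + y\<^sup>2 / 7 \<le> (1 + y) * ln (1 + y)"
proof -
  define u where "u = sqrt (1 + y)"
  have u: "0 < u" "u\<^sup>2 = 1 + y" using assms by (auto simp: u_def)
  have "u \<le> 3 / 2" unfolding u_def using assms
    by (intro real_le_lsqrt) (auto simp: power2_eq_square)
  have "1 - 1 / u \<le> ln u"
    using ln_le_minus_one[of "1 / u"] u(1) by (simp add: ln_div)
  then have "2 * u\<^sup>2 * (1 - 1 / u) \<le> 2 * u\<^sup>2 * ln u"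
    by (intro mult_left_mono) auto
  moreover have "2 * u\<^sup>2 * (1 - 1 / u) = (u\<^sup>2 - 1) + (u - 1)\<^sup>2"
    using u(1) by (simp add: power2_eq_square field_simps)
  moreover have "ln (1 + y) = 2 * ln u"
    unfolding u(2)[symmetric] using u(1) by (simp add: ln_realpow)
  ultimately have 1: "y + (u - 1)\<^sup>2 \<le> (1 + y) * ln (1 + y)"
    unfolding u(2) by (simp add: mult.commute mult.left_commute)
  have "y = (u - 1) * (u + 1)" using u(2) by (simp add: algebra_simps power2_eq_square)
  then have "y\<^sup>2 = (u - 1)\<^sup>2 * (u + 1)\<^sup>2" by (simp add: power_mult_distrib)
  also have "\<dots> \<le> (u - 1)\<^sup>2 * (5/2)\<^sup>2"
    using u \<open>u \<le> 3 / 2\<close> by (intro mult_left_mono power_mono) auto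
  also have "\<dots> \<le> (u - 1)\<^sup>2 * 7" by (intro mult_left_mono) (auto simp: power2_eq_square)
  finally show ?thesis using 1 by simp
qed

text \<open>A record increases the potential \<open>a + (X - u * ln a) / K\<close>, where \<open>a\<close> is the old maximum and
\<open>u\<close> the new value: by concavity of the logarithm \<open>u * (ln u - ln a) \<le> (u / a) * (u - a)\<close>,
and the new value exceeds the old maximum by a factor of at most \<open>K\<close>.\<close>

lemma record_potential_mono:
  fixes u a K X :: real
  assumes "0 < u" "0 < a" "0 < K" "u \<le> a * K"
  shows "a + (X - u * ln a) / K \<le> max a u + (X - u * ln (max a u)) / K"
proof (cases "u \<le> a")
  case False
  have "ln u - ln a = ln (u / a)" using assms by (simp add: ln_div)
  also have "\<dots> \<le> u / a - 1" using assms by (intro ln_le_minus_one) auto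
  finally have "u * (ln u - ln a) \<le> u * ((u - a) / a)"
    using assms by (intro mult_left_mono) (auto simp: diff_divide_distrib)
  also have "\<dots> = (u / a) * (u - a)" by simp
  also have "\<dots> \<le> K * (u - a)"
    using False assms by (intro mult_right_mono) (auto simp: field_simps)
  finally have "u * (ln u - ln a) / K \<le> u - a" using assms by (simp add: field_simps)
  moreover have "(X - u * ln a) / K - (X - u * ln u) / K = u * (ln u - ln a) / K"
    by (simp add: diff_divide_distrib[symmetric] algebra_simps)
  ultimately have "a + (X - u * ln a) / K \<le> u + (X - u * ln u) / K" by linarith
  then show ?thesis using False by simp
qed (simp add: max_def)

section \<open>The random walk and its running maximum\<close>

text \<open>\<open>R\<close> is the number of children of a cell. It is chosen last and very large; \<open>\<delta>\<close> bounds the relative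
change of the density in one generation and depends only on \<open>\<tau>\<close> and \<open>p\<close>.\<close>

locale cascade =
  fixes R :: nat and \<delta> :: real
  assumes R3: "3 \<le> R" and \<delta>_pos: "0 < \<delta>" and \<delta>_le: "\<delta> \<le> 1 / 2"
begin

text \<open>The factor passed on to child number \<open>i\<close>. Its mean over a period is \<open>1\<close>, which makes the cascade
a martingale, and it varies slowly in \<open>i\<close>, also from the last child of a cell to the first child
of the next one. This continuity across cell boundaries separates a doubling measure from one that
is doubling for dyadic intervals only.\<close>

definition wave :: "int \<Rightarrow> real" where
  "wave i = 1 + \<delta> * cos (2 * pi * of_int i / real R)"

lemma wave_bounds: "1 - \<delta> \<le> wave i" "wave i \<le> 1 + \<delta>" "1 / 2 \<le> wave i" "0 < wave i"
proof -
  have "\<bar>\<delta> * cos (2 * pi * of_int i / real R)\<bar> \<le> \<delta> * 1"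
    using \<delta>_pos by (simp add: abs_mult)
  then show "1 - \<delta> \<le> wave i" "wave i \<le> 1 + \<delta>" "1 / 2 \<le> wave i" "0 < wave i"
    using \<delta>_le unfolding wave_def by (auto simp: abs_le_iff)
qed

lemma wave_periodic: "wave (i * int R + d) = wave d"
proof -
  have "2 * pi * of_int (i * int R + d) / real R = 2 * pi * of_int d / real R + of_int i * (2 * pi)"
    using R3 by (simp add: field_simps)
  then show ?thesis unfolding wave_def
    using cos.plus_of_int[of "2 * pi * of_int d / real R" i] by simp
qed

lemma sum_wave: "(\<Sum>d<R. wave (int d)) = real R"
proof -
  have "(\<Sum>d<R. cos (2 * pi * of_int (int d) / real R)) = 0"
    using sum_cos_roots_of_unity[of 1 R] R3 by simp
  then show ?thesis
    unfolding wave_def sum.distrib sum_distrib_left[symmetric] by simp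
qed

text \<open>The entropy gained in one step: \<open>s * ln s\<close> grows by \<open>\<kappa> * s\<close> on average.\<close>

definition \<kappa> :: real where
  "\<kappa> = (\<Sum>d<R. wave (int d) * ln (wave (int d))) / real R"

text \<open>The point of this bound is that it does not depend on \<open>R\<close>: the number of generations is chosen
from it before \<open>R\<close> is.\<close>

lemma \<kappa>_lower: "\<delta>\<^sup>2 / 14 \<le> \<kappa>"
proof -
  let ?c = "\<lambda>d. cos (2 * pi * real d / real R)"
  have c1: "(\<Sum>d<R. ?c d) = 0"
    using sum_cos_roots_of_unity[of 1 R] R3 by simp
  have c2: "(\<Sum>d<R. cos (2 * pi * real 2 * real d / real R)) = 0"
    by (rule sum_cos_roots_of_unity) (use R3 in auto)
  have "(\<Sum>d<R. (?c d)\<^sup>2) = (\<Sum>d<R. 1 / 2 + cos (2 * pi * real 2 * real d / real R) / 2)"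
  proof (intro sum.cong refl)
    fix d
    define t where "t = 2 * pi * real d / real R"
    have t: "2 * pi * real 2 * real d / real R = 2 * t" by (simp add: t_def)
    show "(?c d)\<^sup>2 = 1 / 2 + cos (2 * pi * real 2 * real d / real R) / 2"
      unfolding t unfolding t_def[symmetric] cos_double_cos by argo
  qed
  also have "\<dots> = real R / 2"
    unfolding sum.distrib sum_divide_distrib[symmetric] c2 by simp
  finally have sq: "(\<Sum>d<R. (?c d)\<^sup>2) = real R / 2" .
  have "(\<Sum>d<R. \<delta> * ?c d + (\<delta> * ?c d)\<^sup>2 / 7) \<le> (\<Sum>d<R. wave (int d) * ln (wave (int d)))"
  proof (intro sum_mono)
    fix d
    define y where "y = \<delta> * ?c d"
    have "\<bar>y\<bar> \<le> (1/2) * 1"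
      unfolding y_def abs_mult using \<delta>_pos \<delta>_le by (intro mult_mono) auto
    moreover have "wave (int d) = 1 + y" unfolding wave_def y_def by simp
    ultimately show "\<delta> * ?c d + (\<delta> * ?c d)\<^sup>2 / 7 \<le> wave (int d) * ln (wave (int d))"
      unfolding y_def[symmetric] using entropy_lower_bound[of y] by simp
  qed
  moreover have "(\<Sum>d<R. \<delta> * ?c d + (\<delta> * ?c d)\<^sup>2 / 7) = \<delta>\<^sup>2 * (real R / 2) / 7"
    unfolding sum.distrib power_mult_distrib sum_divide_distrib[symmetric]
      sum_distrib_left[symmetric] sq c1 by (simp only: mult_zero_right add_0)
  ultimately have "\<delta>\<^sup>2 / 14 * real R \<le> (\<Sum>d<R. wave (int d) * ln (wave (int d)))" by simp
  then show ?thesis using R3 unfolding \<kappa>_def by (subst pos_le_divide_eq) auto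
qed

text \<open>Cells of generation \<open>m\<close> are numbered by the integers, and the children of cell \<open>i\<close> are the cells
\<open>i * R, \<dots>, i * R + R - 1\<close>, so that \<open>i div R\<close> is the parent of \<open>i\<close>. Along a line of descent \<open>S\<close> is
the multiplicative random walk and \<open>M\<close> is its running maximum.\<close>

primrec S :: "nat \<Rightarrow> int \<Rightarrow> real" where
  "S 0 i = 1"
| "S (Suc m) i = S m (i div int R) * wave i"

primrec M :: "nat \<Rightarrow> int \<Rightarrow> real" where
  "M 0 i = 1"
| "M (Suc m) i = max (M m (i div int R)) (S (Suc m) i)"

lemma S_pos: "0 < S m i"
  by (induction m arbitrary: i) (auto simp: wave_bounds)

lemma S_le_M: "S m i \<le> M m i"
  by (cases m) auto

lemma M_pos: "0 < M m i"
  using S_pos S_le_M less_le_trans by blast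

text \<open>The conditional expectation of \<open>F S M\<close> after \<open>k\<close> further steps, given the present state
\<open>(s, a)\<close> of the walk and its maximum.\<close>

primrec expect :: "nat \<Rightarrow> (real \<Rightarrow> real \<Rightarrow> real) \<Rightarrow> real \<Rightarrow> real \<Rightarrow> real" where
  "expect 0 F s a = F s a"
| "expect (Suc k) F s a =
     (\<Sum>d<R. expect k F (s * wave (int d)) (max a (s * wave (int d)))) / real R"

lemma expect_pos:
  assumes "\<And>s a. 0 < s \<Longrightarrow> 0 < a \<Longrightarrow> 0 < F s a" "0 < s" "0 < a"
  shows "0 < expect k F s a"
  using assms(2,3)
proof (induction k arbitrary: s a)
  case (Suc k)
  have "0 < (\<Sum>d<R. expect k F (s * wave (int d)) (max a (s * wave (int d))))"
    using R3 by (intro sum_pos Suc.IH) (auto simp: Suc.prems wave_bounds less_max_iff_disj lessThan_empty_iff)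
  then show ?case using R3 by simp
qed (simp add: assms)

lemma expect_fst: "expect k (\<lambda>s a. s) s a = s"
proof (induction k arbitrary: s a)
  case (Suc k)
  then show ?case using R3
    unfolding expect.simps Suc.IH sum_distrib_left[symmetric] sum_wave by simp
qed simp

lemma expect_antitone_le:
  assumes "\<And>a b. 0 < a \<Longrightarrow> a \<le> b \<Longrightarrow> g b \<le> g a" "0 < a"
  shows "expect k (\<lambda>s. g) s a \<le> g a"
  using assms(2)
proof (induction k arbitrary: s a)
  case (Suc k)
  have "(\<Sum>d<R. expect k (\<lambda>s. g) (s * wave (int d)) (max a (s * wave (int d)))) \<le> (\<Sum>d<R. g a)"
  proof (intro sum_mono)
    fix d
    have "expect k (\<lambda>s. g) (s * wave (int d)) (max a (s * wave (int d))) \<le> g (max a (s * wave (int d)))"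
      using Suc by simp
    also have "\<dots> \<le> g a" using Suc.prems by (intro assms(1)) auto
    finally show "expect k (\<lambda>s. g) (s * wave (int d)) (max a (s * wave (int d))) \<le> g a" .
  qed
  then show ?case using R3 by (simp add: field_simps)
qed simp

text \<open>The reverse of Doob's \<open>L log L\<close> inequality. At \<open>s = a = 1\<close> it says that the expected maximum grows
at least linearly in the number of steps, although the walk itself has expectation \<open>1\<close>. The left
side is a potential whose average over one step does not decrease: the entropy term gains exactly
\<open>\<kappa> * s\<close>, which pays for the lost step, and passing to the new maximum can only help by
\<open>record_potential_mono\<close>.\<close>

lemma expect_max_ge:
  assumes "0 < s" "s \<le> a"
  shows "a + (s * ln s + real k * \<kappa> * s - s * ln a) / (1 + \<delta>) \<le> expect k (\<lambda>s a. a) s a"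
  using assms
proof (induction k arbitrary: s a)
  case 0
  have "s * ln s \<le> s * ln a" using 0 by (intro mult_left_mono) auto
  then show ?case using \<delta>_pos by (simp add: field_simps)
next
  case (Suc k)
  let ?s = "\<lambda>d. s * wave (int d)"
  let ?a = "\<lambda>d. max a (?s d)"
  let ?P = "\<lambda>d. a + (?s d * ln (?s d) + real k * \<kappa> * ?s d - ?s d * ln a) / (1 + \<delta>)"
  have "(\<Sum>d<R. ?P d) \<le> (\<Sum>d<R. expect k (\<lambda>s a. a) (?s d) (?a d))"
  proof (intro sum_mono)
    fix d
    have sd: "0 < ?s d" using Suc.prems wave_bounds by simp
    have "?s d \<le> a * (1 + \<delta>)" using Suc.prems wave_bounds[of "int d"] by (intro mult_mono) auto
    then have "?P d \<le> ?a d + (?s d * ln (?s d) + real k * \<kappa> * ?s d - ?s d * ln (?a d)) / (1 + \<delta>)"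
      using sd Suc.prems \<delta>_pos by (intro record_potential_mono) auto
    also have "\<dots> \<le> expect k (\<lambda>s a. a) (?s d) (?a d)"
      using sd by (intro Suc.IH) auto
    finally show "?P d \<le> expect k (\<lambda>s a. a) (?s d) (?a d)" .
  qed
  moreover have "(\<Sum>d<R. ?P d) = real R * (a + (s * ln s + real (Suc k) * \<kappa> * s - s * ln a) / (1 + \<delta>))"
  proof -
    have "(\<Sum>d<R. ?s d * ln (?s d)) = (\<Sum>d<R. s * ln s * wave (int d) + s * (wave (int d) * ln (wave (int d))))"
      using Suc.prems wave_bounds by (intro sum.cong refl) (simp add: ln_mult_pos algebra_simps)
    also have "\<dots> = real R * (s * ln s + s * \<kappa>)"
      unfolding sum.distrib sum_distrib_left[symmetric] sum_wave \<kappa>_def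
      using R3 by (simp add: field_simps)
    finally have e: "(\<Sum>d<R. ?s d * ln (?s d)) = real R * (s * ln s + s * \<kappa>)" .
    have w: "(\<Sum>d<R. ?s d) = s * real R" unfolding sum_distrib_left[symmetric] sum_wave ..
    have "(\<Sum>d<R. ?P d) = real R * a + ((\<Sum>d<R. ?s d * ln (?s d))
        + real k * \<kappa> * (\<Sum>d<R. ?s d) - (\<Sum>d<R. ?s d) * ln a) / (1 + \<delta>)"
      by (simp only: sum.distrib sum_subtractf sum_divide_distrib[symmetric]
          sum_distrib_left[symmetric] sum_distrib_right[symmetric]) simp
    also have "\<dots> = real R * a
        + (real R * (s * ln s + real (Suc k) * \<kappa> * s - s * ln a)) / (1 + \<delta>)"
      unfolding e w by (rule arg_cong[where f = "\<lambda>z. real R * a + z / (1 + \<delta>)"]) (simp add: algebra_simps)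
    finally show ?thesis by (simp add: distrib_left)
  qed
  ultimately have "real R * (a + (s * ln s + real (Suc k) * \<kappa> * s - s * ln a) / (1 + \<delta>))
      \<le> (\<Sum>d<R. expect k (\<lambda>s a. a) (?s d) (?a d))" by simp
  then show ?case using R3 by (simp only: expect.simps) (simp add: pos_le_divide_eq mult.commute)
qed

end

section \<open>Comparing neighbouring cells\<close>

text \<open>\<open>F\<close> is Lipschitz on the positive quadrant with constant \<open>P\<close> when both sides are measured
logarithmically (in the maximum norm). The condition is inherited by conditional expectations, so
one estimate for the walk serves both measures.\<close>

definition log_lipschitz :: "real \<Rightarrow> (real \<Rightarrow> real \<Rightarrow> real) \<Rightarrow> bool" where
  "log_lipschitz P F \<longleftrightarrow>
     (\<forall>s a s' a' t. 0 < s \<longrightarrow> 0 < a \<longrightarrow> 0 < s' \<longrightarrow> 0 < a' \<longrightarrow> 1 \<le> t \<longrightarrow>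
        s \<le> t * s' \<longrightarrow> s' \<le> t * s \<longrightarrow> a \<le> t * a' \<longrightarrow> a' \<le> t * a \<longrightarrow>
        F s a \<le> t powr P * F s' a')"

lemma log_lipschitzD:
  assumes "log_lipschitz P F" "0 < s" "0 < a" "0 < s'" "0 < a'" "1 \<le> t"
    "s \<le> t * s'" "s' \<le> t * s" "a \<le> t * a'" "a' \<le> t * a"
  shows "F s a \<le> t powr P * F s' a'"
  using assms unfolding log_lipschitz_def by blast

lemma log_lipschitz_fst:
  assumes "1 \<le> P"
  shows "log_lipschitz P (\<lambda>s a. s)"
  unfolding log_lipschitz_def
proof (intro allI impI)
  fix s a s' a' t :: real
  assume *: "0 < s'" "1 \<le> t" "s \<le> t * s'"
  have "t \<le> t powr P" using * powr_mono[of 1 P t] assms by simp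
  then have "t * s' \<le> t powr P * s'" using * by simp
  then show "s \<le> t powr P * s'" using * by linarith
qed

lemma log_lipschitz_neg_powr:
  assumes "1 \<le> p" "p - 1 \<le> P"
  shows "log_lipschitz P (\<lambda>s a. a powr (1 - p))"
  unfolding log_lipschitz_def
proof (intro allI impI)
  fix s a s' a' t :: real
  assume *: "0 < a" "0 < a'" "1 \<le> t" "a' \<le> t * a"
  have "a powr (1 - p) \<le> (a' / t) powr (1 - p)"
    using * assms by (intro powr_mono2') (auto simp: field_simps)
  also have "\<dots> = t powr (p - 1) * a' powr (1 - p)"
    using * by (simp add: powr_divide powr_diff field_simps)
  also have "\<dots> \<le> t powr P * a' powr (1 - p)"
    using * assms by (intro mult_right_mono powr_mono) auto
  finally show "a powr (1 - p) \<le> t powr P * a' powr (1 - p)" .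
qed

context cascade
begin

lemma log_lipschitz_expect:
  assumes "log_lipschitz P F"
  shows "log_lipschitz P (expect k F)"
proof (induction k)
  case (Suc k)
  show ?case unfolding log_lipschitz_def
  proof (intro allI impI)
    fix s a s' a' t :: real
    assume *: "0 < s" "0 < a" "0 < s'" "0 < a'" "1 \<le> t"
      "s \<le> t * s'" "s' \<le> t * s" "a \<le> t * a'" "a' \<le> t * a"
    have "(\<Sum>d<R. expect k F (s * wave (int d)) (max a (s * wave (int d)))) \<le>
      (\<Sum>d<R. t powr P * expect k F (s' * wave (int d)) (max a' (s' * wave (int d))))"
    proof (intro sum_mono log_lipschitzD[OF Suc])
      fix d
      let ?w = "wave (int d)"
      have w: "0 < ?w" by (rule wave_bounds)
      show st: "s * ?w \<le> t * (s' * ?w)" "s' * ?w \<le> t * (s * ?w)"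
        using * w by (simp_all flip: mult.assoc)
      have "t * a' \<le> t * max a' (s' * ?w)" "t * (s' * ?w) \<le> t * max a' (s' * ?w)"
        "t * a \<le> t * max a (s * ?w)" "t * (s * ?w) \<le> t * max a (s * ?w)"
        using * by (auto intro!: mult_left_mono)
      then show "max a (s * ?w) \<le> t * max a' (s' * ?w)" "max a' (s' * ?w) \<le> t * max a (s * ?w)"
        using st * by (intro max.boundedI; linarith)+
    qed (use * wave_bounds in \<open>auto simp: less_max_iff_disj\<close>)
    then show "expect (Suc k) F s a \<le> t powr P * expect (Suc k) F s' a'"
      using R3 unfolding expect.simps sum_distrib_left[symmetric] times_divide_eq_right
      by (intro divide_right_mono) auto
  qed
qed (use assms in \<open>simp add: log_lipschitz_def\<close>)

text \<open>The states in two cells of the same generation agree up to the factor \<open>t\<close>.\<close>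

definition close :: "real \<Rightarrow> nat \<Rightarrow> int \<Rightarrow> int \<Rightarrow> bool" where
  "close t m i j \<longleftrightarrow>
     S m i \<le> t * S m j \<and> S m j \<le> t * S m i \<and> M m i \<le> t * M m j \<and> M m j \<le> t * M m i"

lemma close_sym: "close t m i j \<longleftrightarrow> close t m j i"
  by (auto simp: close_def)

lemma close_refl: "1 \<le> t \<Longrightarrow> close t m i i"
  using S_pos[of m i] M_pos[of m i] by (auto simp: close_def mult_le_cancel_right1)

lemma close_mono:
  assumes "close t m i j" "t \<le> u"
  shows "close u m i j"
proof -
  have "t * z \<le> u * z" if "0 < z" for z :: real using assms that by simp
  then show ?thesis using assms S_pos M_pos unfolding close_def by (meson order_trans)
qed

lemma close_trans:
  assumes "close t m i j" "close u m j k" "0 \<le> t" "0 \<le> u"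
  shows "close (t * u) m i k"
proof -
  have *: "x \<le> t * u * z" if "x \<le> t * y" "y \<le> u * z" for x y z
  proof -
    have "t * y \<le> t * (u * z)" using that assms by (intro mult_left_mono) auto
    then show ?thesis using that by simp
  qed
  have **: "x \<le> t * u * z" if "y \<le> t * z" "x \<le> u * y" for x y z
  proof -
    have "u * y \<le> u * (t * z)" using that assms by (intro mult_left_mono) auto
    then show ?thesis using that by (simp add: mult_ac)
  qed
  show ?thesis using assms(1,2) unfolding close_def by (meson * **)
qed

text \<open>Parents that agree up to \<open>t\<close> have children that agree up to \<open>t * u\<close> when their last factors agree
up to \<open>u\<close>.\<close>

lemma close_Suc:
  assumes "close t m (i div int R) (j div int R)" "1 \<le> t" "1 \<le> u"
    "wave i \<le> u * wave j" "wave j \<le> u * wave i"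
  shows "close (t * u) (Suc m) i j"
proof -
  have S: "S (Suc m) i \<le> t * u * S (Suc m) j"
    if "S m (i div int R) \<le> t * S m (j div int R)" "wave i \<le> u * wave j" for i j
  proof -
    have "S (Suc m) i \<le> (t * S m (j div int R)) * (u * wave j)"
      unfolding S.simps using that S_pos[of m "j div int R"] wave_bounds(4)[of i] assms
      by (intro mult_mono) (auto intro: less_imp_le)
    then show ?thesis by (simp add: mult_ac)
  qed
  have M: "M (Suc m) i \<le> t * u * M (Suc m) j"
    if "S (Suc m) i \<le> t * u * S (Suc m) j" "M m (i div int R) \<le> t * M m (j div int R)" for i j
  proof -
    have tu: "t \<le> t * u" "0 \<le> t * u" using assms by (simp_all add: mult_le_cancel_left1)
    have "M m (i div int R) \<le> t * u * M m (j div int R)"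
      using that(2) mult_right_mono[OF tu(1), of "M m (j div int R)"] M_pos[of m "j div int R"] by linarith
    also have "\<dots> \<le> t * u * M (Suc m) j" using tu by (intro mult_left_mono) auto
    finally have "M m (i div int R) \<le> t * u * M (Suc m) j" .
    moreover have "t * u * S (Suc m) j \<le> t * u * M (Suc m) j"
      using tu S_le_M by (intro mult_left_mono) auto
    ultimately show ?thesis using that(1) by (simp del: S.simps)
  qed
  show ?thesis using assms(1,4,5) S M unfolding close_def by blast
qed

lemma wave_neighbour:
  assumes "\<bar>i - j\<bar> \<le> 1"
  shows "wave i \<le> exp (8 / real R) * wave j"
proof -
  have "\<bar>2 * pi * of_int i / real R - 2 * pi * of_int j / real R\<bar> = 2 * pi / real R * of_int \<bar>i - j\<bar>"
  proof -
    have "2 * pi * of_int i / real R - 2 * pi * of_int j / real R = 2 * pi / real R * of_int (i - j)"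
      by (simp add: algebra_simps diff_divide_distrib)
    then show ?thesis by (simp add: abs_mult)
  qed
  also have "\<dots> \<le> 2 * pi / real R * of_int 1"
    using assms by (intro mult_left_mono) (simp_all only: of_int_le_iff, simp)
  also have "\<dots> \<le> 8 / real R" using pi_less_4 by (auto intro!: divide_right_mono)
  finally have "\<bar>cos (2 * pi * of_int i / real R) - cos (2 * pi * of_int j / real R)\<bar> \<le> 8 / real R"
    using abs_cos_diff_le order_trans by blast
  then have "\<bar>\<delta> * (cos (2 * pi * of_int i / real R) - cos (2 * pi * of_int j / real R))\<bar> \<le> 1 / 2 * (8 / real R)"
    unfolding abs_mult using \<delta>_pos \<delta>_le by (intro mult_mono) auto
  then have "wave i \<le> wave j + 1 / 2 * (8 / real R)"
    unfolding wave_def by (simp add: algebra_simps)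
  also have "1 / 2 * (8 / real R) \<le> wave j * (8 / real R)"
    using wave_bounds(3)[of j] by (intro mult_right_mono) auto
  also have "wave j + wave j * (8 / real R) = (1 + 8 / real R) * wave j"
    by (simp add: algebra_simps)
  also have "\<dots> \<le> exp (8 / real R) * wave j"
    using wave_bounds(4)[of j] by (intro mult_right_mono exp_ge_add_one_self) auto
  finally show ?thesis by simp
qed

text \<open>Passing from a cell to its right neighbour moves each ancestor by at most one place, hence changes
each of the \<open>m\<close> factors by at most \<open>exp (8 / R)\<close>. The total is close to \<open>1\<close> as soon as \<open>R\<close> is much
larger than the number of generations.\<close>

lemma close_neighbour: "close (exp (8 * real m / real R)) m i (i + 1)"
proof (induction m arbitrary: i)
  case (Suc m)
  have "i div int R \<le> (i + 1) div int R" "(i + 1) div int R \<le> (i + int R) div int R"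
    using R3 by (intro zdiv_mono1; simp)+
  then have "(i + 1) div int R = i div int R \<or> (i + 1) div int R = i div int R + 1"
    using R3 by auto
  then have "close (exp (8 * real m / real R)) m (i div int R) ((i + 1) div int R)"
    using Suc close_refl by (auto simp: close_refl)
  then have "close (exp (8 * real m / real R) * exp (8 / real R)) (Suc m) i (i + 1)"
    by (rule close_Suc) (auto intro: wave_neighbour)
  then show ?case by (simp add: exp_add[symmetric] add_divide_distrib[symmetric] algebra_simps)
qed (simp add: close_def)

lemma close_distance:
  assumes "\<bar>i - j\<bar> \<le> int q"
  shows "close (exp (8 * real m * real q / real R)) m i j"
proof -
  have *: "close (exp (8 * real m * real k / real R)) m i (i + int k)" for k i
  proof (induction k)
    case (Suc k)
    have "close (exp (8 * real m * real k / real R) * exp (8 * real m / real R)) m i (i + int k + 1)"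
      by (rule close_trans[OF Suc close_neighbour]) auto
    then show ?case by (simp add: exp_add[symmetric] add_divide_distrib[symmetric] algebra_simps)
  qed (simp add: close_refl)
  have **: "close (exp (8 * real m * real q / real R)) m i j" if "i \<le> j" "j - i \<le> int q" for i j
  proof -
    have "close (exp (8 * real m * real (nat (j - i)) / real R)) m i j"
      using *[of "nat (j - i)" i] that by simp
    then show ?thesis
      by (rule close_mono) (use that R3 in \<open>auto intro!: divide_right_mono mult_left_mono\<close>)
  qed
  show ?thesis using **[of i j] **[of j i] close_sym assms by fastforce
qed

lemma floor_parent: "\<lfloor>x * real R ^ m\<rfloor> = \<lfloor>x * real R ^ Suc m\<rfloor> div int R"
proof -
  have "x * real R ^ m = x * real R ^ Suc m / real_of_int (int R)" using R3 by simp
  then show ?thesis using floor_divide_real_eq_div[of "int R" "x * real R ^ Suc m"] by simp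
qed

text \<open>Every interval has a generation that resolves it and on which the walk is almost constant: the
first one whose cells are shorter than the interval by a factor of \<open>q\<close>. The parents of the cells
in question then lie within \<open>q\<close> places of each other, so their states nearly agree as long as
\<open>n * q\<close> is small against \<open>R\<close>, and the step from the parents to the cells costs at most the range
\<open>(1 + \<delta>) / (1 - \<delta>)\<close> of the last factor. Long intervals get generation \<open>0\<close>, where all cells
carry the same state. Very short intervals get the last generation \<open>n\<close>, on
whose cells the densities are constant.\<close>

lemma scale_of_interval:
  assumes "x < y"
  obtains m where "m \<le> n" "m = n \<or> real q \<le> (y - x) * real R ^ m"
    "\<And>i j. i \<in> {\<lfloor>x * real R ^ m\<rfloor>..\<lfloor>y * real R ^ m\<rfloor>} \<Longrightarrow> j \<in> {\<lfloor>x * real R ^ m\<rfloor>..\<lfloor>y * real R ^ m\<rfloor>} \<Longrightarrow>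
      close (exp (8 * real n * real q / real R) * ((1 + \<delta>) / (1 - \<delta>))) m i j"
proof -
  define m where "m = (LEAST m. m = n \<or> real q \<le> (y - x) * real R ^ m)"
  let ?T = "exp (8 * real n * real q / real R)"
  let ?u = "(1 + \<delta>) / (1 - \<delta>)"
  have u: "1 \<le> ?u" using \<delta>_pos \<delta>_le by simp
  have m: "m = n \<or> real q \<le> (y - x) * real R ^ m"
    unfolding m_def by (rule LeastI[of _ n]) simp
  have mn: "m \<le> n" unfolding m_def by (rule Least_le) simp
  have "close (?T * ?u) m i j"
    if ij: "i \<in> {\<lfloor>x * real R ^ m\<rfloor>..\<lfloor>y * real R ^ m\<rfloor>}" "j \<in> {\<lfloor>x * real R ^ m\<rfloor>..\<lfloor>y * real R ^ m\<rfloor>}" for i j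
  proof (cases m)
    case 0
    have "1 * 1 \<le> ?T * ?u" using u by (intro mult_mono) auto
    then show ?thesis unfolding 0 close_def by simp
  next
    case (Suc l)
    then have "l < m" by simp
    then have l: "(y - x) * real R ^ l < real q"
      using not_less_Least[of l "\<lambda>m. m = n \<or> real q \<le> (y - x) * real R ^ m"] unfolding m_def by auto
    have "\<lfloor>x * real R ^ l\<rfloor> \<le> k div int R" "k div int R \<le> \<lfloor>y * real R ^ l\<rfloor>"
      if "k \<in> {\<lfloor>x * real R ^ m\<rfloor>..\<lfloor>y * real R ^ m\<rfloor>}" for k
      using that R3 unfolding floor_parent[of x l] floor_parent[of y l] Suc by (auto intro!: zdiv_mono1)
    moreover have "real_of_int (\<lfloor>y * real R ^ l\<rfloor> - \<lfloor>x * real R ^ l\<rfloor>) < real_of_int (int q + 1)"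
      using l by (simp add: algebra_simps) linarith
    then have "\<lfloor>y * real R ^ l\<rfloor> - \<lfloor>x * real R ^ l\<rfloor> \<le> int q" by linarith
    ultimately have "\<bar>i div int R - j div int R\<bar> \<le> int q" using ij by (smt (verit))
    then have "close (exp (8 * real l * real q / real R)) l (i div int R) (j div int R)"
      by (rule close_distance)
    then have "close ?T l (i div int R) (j div int R)"
      by (rule close_mono) (use \<open>l < m\<close> mn in \<open>auto intro!: divide_right_mono mult_right_mono\<close>)
    moreover have "wave i \<le> ?u * wave j" for i j
    proof -
      have "wave i \<le> 1 + \<delta>" by (rule wave_bounds)
      also have "\<dots> = ?u * (1 - \<delta>)" using \<delta>_le by simp
      also have "\<dots> \<le> ?u * wave j" using u by (intro mult_left_mono wave_bounds) auto
      finally show ?thesis .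
    qed
    ultimately show ?thesis unfolding Suc using u by (intro close_Suc) auto
  qed
  with m mn that show thesis by blast
qed

end

section \<open>The cascade measures and their values on intervals\<close>

lemma bounded_intervalsE:
  assumes "J \<in> bounded_intervals"
  obtains x y where "x < y" "{x<..<y} \<subseteq> J" "J \<subseteq> {x..y}" "J \<in> sets borel" "midpt J = (x + y) / 2"
proof -
  from assms have J: "is_interval J" "bounded J" "interior J \<noteq> {}"
    by (auto simp: bounded_intervals_def)
  then obtain z where "z \<in> interior J" by blast
  then obtain e where e: "0 < e" "cball z e \<subseteq> J"
    by (meson mem_interior_cball)
  then have ze: "z - e \<in> J" "z + e \<in> J" by (auto simp: cball_def dist_real_def subset_iff)
  have bdd: "bdd_above J" "bdd_below J" using J(2) by (auto intro: bounded_imp_bdd_above bounded_imp_bdd_below)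
  have "Inf J \<le> z - e" "z + e \<le> Sup J" using ze bdd by (auto intro: cInf_lower cSup_upper)
  then have "Inf J < Sup J" using e by linarith
  moreover have "J \<subseteq> {Inf J..Sup J}" using bdd by (auto intro: cInf_lower cSup_upper)
  moreover have "{Inf J<..<Sup J} \<subseteq> J"
  proof
    fix w assume "w \<in> {Inf J<..<Sup J}"
    then obtain u v where "u \<in> J" "u < w" "v \<in> J" "w < v"
      using ze bdd cInf_less_iff[of J w] less_cSup_iff[of J w] by auto
    then show "w \<in> J" using J(1) unfolding is_interval_1 by (meson less_imp_le)
  qed
  moreover have "J \<in> sets borel" using J(1) by (rule real_interval_borel_measurable)
  ultimately show thesis using that[of "Inf J" "Sup J"] by (auto simp: midpt_def)
qed

lemma emeasure_lborel_between:
  assumes "x < y" "{x<..<y} \<subseteq> J" "J \<subseteq> {x..y}" "J \<in> sets borel"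
  shows "emeasure lborel J = ennreal (y - x)"
proof (rule antisym)
  have "emeasure lborel J \<le> emeasure lborel {x..y}" using assms by (intro emeasure_mono) auto
  then show "emeasure lborel J \<le> ennreal (y - x)" using assms by simp
  have "emeasure lborel {x<..<y} \<le> emeasure lborel J" using assms by (intro emeasure_mono) auto
  then show "ennreal (y - x) \<le> emeasure lborel J" using assms by simp
qed

lemma emeasure_consecutive_cells:
  fixes \<mu> :: "real measure" and h :: real and a b :: int
  assumes "sets \<mu> = sets borel" "0 < h" "a \<le> b"
  shows "emeasure \<mu> {of_int a / h ..< of_int b / h} =
    (\<Sum>i\<in>{a..<b}. emeasure \<mu> {of_int i / h ..< (of_int i + 1) / h})"
  using \<open>a \<le> b\<close>
proof (induction b rule: int_ge_induct)
  case (step b)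
  have "{of_int a / h ..< of_int (b + 1) / h} =
      {of_int a / h ..< of_int b / h} \<union> {of_int b / h ..< (of_int b + 1) / h}"
    using step assms(2) by (subst ivl_disj_un) (auto simp: divide_right_mono)
  moreover have "emeasure \<mu> ({of_int a / h ..< of_int b / h} \<union> {of_int b / h ..< (of_int b + 1) / h})
      = emeasure \<mu> {of_int a / h ..< of_int b / h} + emeasure \<mu> {of_int b / h ..< (of_int b + 1) / h}"
    using assms by (intro plus_emeasure[symmetric]) auto
  moreover have "{a..<b + 1} = insert b {a..<b}" using step by auto
  ultimately show ?case using step by (simp add: add.commute)
qed simp

context cascade
begin

definition cell :: "nat \<Rightarrow> int \<Rightarrow> real set" where
  "cell m i = {of_int i / real R ^ m ..< (of_int i + 1) / real R ^ m}"

definition density_at :: "nat \<Rightarrow> (real \<Rightarrow> real \<Rightarrow> real) \<Rightarrow> real \<Rightarrow> real" where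
  "density_at n F x = F (S n \<lfloor>x * real R ^ n\<rfloor>) (M n \<lfloor>x * real R ^ n\<rfloor>)"

text \<open>The walk is run for \<open>n\<close> generations and its final state fed to \<open>F\<close>: for \<open>F s a = s\<close> this gives
\<open>\<sigma>\<close>, for \<open>F s a = a powr (1 - p)\<close> it gives \<open>\<omega>\<close>.\<close>

definition cascade_measure :: "nat \<Rightarrow> (real \<Rightarrow> real \<Rightarrow> real) \<Rightarrow> real measure" where
  "cascade_measure n F = density lborel (\<lambda>x. ennreal (density_at n F x))"

text \<open>
By the martingale property this is the mean of the density over cell \<open>i\<close> of generation \<open>m\<close>, for
\<open>m \<le> n\<close> (\<open>emeasure_cell\<close>).\<close>

definition average :: "nat \<Rightarrow> (real \<Rightarrow> real \<Rightarrow> real) \<Rightarrow> nat \<Rightarrow> int \<Rightarrow> real" where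
  "average n F m i = expect (n - m) F (S m i) (M m i)"

lemma Rm_pos: "0 < real R ^ m"
  using R3 by simp

lemma mem_cell_iff: "x \<in> cell m i \<longleftrightarrow> \<lfloor>x * real R ^ m\<rfloor> = i"
  using Rm_pos[of m] by (auto simp: cell_def floor_eq_iff pos_divide_le_eq pos_less_divide_eq)

lemma cell_borel [measurable, simp]: "cell m i \<in> sets borel"
  by (simp add: cell_def)

lemma measurable_density_at [measurable]: "density_at n F \<in> borel_measurable borel"
proof -
  have "(\<lambda>x::real. \<lfloor>x * real R ^ n\<rfloor>) \<in> measurable borel (count_space UNIV)" by measurable
  moreover have "(\<lambda>i. F (S n i) (M n i)) \<in> borel_measurable (count_space UNIV)" by simp
  ultimately show ?thesis unfolding density_at_def[abs_def] by (rule measurable_compose)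
qed

lemma sets_cascade_measure [measurable_cong, simp]: "sets (cascade_measure n F) = sets borel"
  by (simp add: cascade_measure_def)

lemma emeasure_cascade_measure:
  "J \<in> sets borel \<Longrightarrow>
    emeasure (cascade_measure n F) J = (\<integral>\<^sup>+x. ennreal (density_at n F x) * indicator J x \<partial>lborel)"
  unfolding cascade_measure_def by (rule emeasure_density) auto

lemma emeasure_lborel_cell: "emeasure lborel (cell m i) = ennreal (1 / real R ^ m)"
proof -
  have "of_int i / real R ^ m \<le> (of_int i + 1) / real R ^ m"
    using Rm_pos by (intro divide_right_mono) auto
  then show ?thesis unfolding cell_def
    by (subst emeasure_lborel_Ico) (auto simp: diff_divide_distrib[symmetric])
qed

lemma average_top: "average n F n i = F (S n i) (M n i)"
  by (simp add: average_def)

lemma average_pos: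
  assumes "\<And>s a. 0 < s \<Longrightarrow> 0 < a \<Longrightarrow> 0 < F s a"
  shows "0 < average n F m i"
  unfolding average_def using assms S_pos M_pos by (rule expect_pos)

lemma average_children:
  assumes "m < n"
  shows "average n F m i = (\<Sum>j\<in>{i * int R..<(i + 1) * int R}. average n F (Suc m) j) / real R"
proof -
  have bij: "bij_betw (\<lambda>d. i * int R + int d) {..<R} {i * int R..<(i + 1) * int R}"
    by (rule bij_betwI[where g = "\<lambda>j. nat (j - i * int R)"]) (auto simp: algebra_simps)
  have "average n F (Suc m) (i * int R + int d) =
      expect (n - Suc m) F (S m i * wave (int d)) (max (M m i) (S m i * wave (int d)))" if "d < R" for d
  proof -
    have "(i * int R + int d) div int R = i" using that by simp
    then show ?thesis by (simp add: average_def wave_periodic)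
  qed
  moreover have "n - m = Suc (n - Suc m)" using assms by simp
  ultimately have "average n F m i = (\<Sum>d<R. average n F (Suc m) (i * int R + int d)) / real R"
    by (simp add: average_def)
  then show ?thesis using sum.reindex_bij_betw[OF bij, of "average n F (Suc m)"] by simp
qed

lemma emeasure_cells:
  assumes "a \<le> b"
  shows "emeasure (cascade_measure n F) {of_int a / real R ^ m ..< of_int b / real R ^ m} =
    (\<Sum>i\<in>{a..<b}. emeasure (cascade_measure n F) (cell m i))"
  unfolding cell_def using Rm_pos assms by (intro emeasure_consecutive_cells) auto

lemma emeasure_cell:
  assumes "\<And>s a. 0 < s \<Longrightarrow> 0 < a \<Longrightarrow> 0 < F s a" "m \<le> n"
  shows "emeasure (cascade_measure n F) (cell m i) = ennreal (average n F m i / real R ^ m)"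
  using \<open>m \<le> n\<close>
proof (induction m arbitrary: i rule: inc_induct)
  case base
  have "emeasure (cascade_measure n F) (cell n i) =
      (\<integral>\<^sup>+x. ennreal (average n F n i) * indicator (cell n i) x \<partial>lborel)"
    by (subst emeasure_cascade_measure)
      (auto simp: mem_cell_iff density_at_def average_top intro!: nn_integral_cong split: split_indicator)
  also have "\<dots> = ennreal (average n F n i) * ennreal (1 / real R ^ n)"
    by (subst nn_integral_cmult_indicator) (auto simp: emeasure_lborel_cell)
  also have "\<dots> = ennreal (average n F n i / real R ^ n)"
    using average_pos[of F n n i] assms(1) by (subst ennreal_mult[symmetric]) (auto intro: less_imp_le)
  finally show ?case .
next
  case (step m)
  have "cell m i = {of_int (i * int R) / real R ^ Suc m ..< of_int ((i + 1) * int R) / real R ^ Suc m}"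
    using R3 by (simp add: cell_def)
  then have "emeasure (cascade_measure n F) (cell m i) =
      (\<Sum>j\<in>{i * int R..<(i + 1) * int R}. emeasure (cascade_measure n F) (cell (Suc m) j))"
    using emeasure_cells[of "i * int R" "(i + 1) * int R" n F "Suc m"] by (simp add: mult_right_mono)
  also have "\<dots> = (\<Sum>j\<in>{i * int R..<(i + 1) * int R}. ennreal (average n F (Suc m) j / real R ^ Suc m))"
    by (simp only: step.IH)
  also have "\<dots> = ennreal (\<Sum>j\<in>{i * int R..<(i + 1) * int R}. average n F (Suc m) j / real R ^ Suc m)"
    using assms(1) by (intro sum_ennreal divide_nonneg_nonneg less_imp_le[OF average_pos]) auto
  also have "\<dots> = ennreal (average n F m i / real R ^ m)"
    unfolding average_children[OF step.hyps(2)] sum_divide_distrib[symmetric] by (simp add: field_simps)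
  finally show ?case .
qed

text \<open>An interval much longer than the cells of generation \<open>m\<close> is a union of such cells up to two
incomplete ones at its ends; these account for a proportion of at most \<open>e\<close>. In the last generation
no loss occurs, since there the averages are the density itself.\<close>

lemma emeasure_interval_bounds:
  assumes F: "\<And>s a. 0 < s \<Longrightarrow> 0 < a \<Longrightarrow> 0 < F s a" and "m \<le> n"
    and J: "x < y" "{x<..<y} \<subseteq> J" "J \<subseteq> {x..y}" "J \<in> sets borel"
    and ab: "0 < a" "\<And>i. i \<in> {\<lfloor>x * real R ^ m\<rfloor>..\<lfloor>y * real R ^ m\<rfloor>} \<Longrightarrow> a \<le> average n F m i"
      "\<And>i. i \<in> {\<lfloor>x * real R ^ m\<rfloor>..\<lfloor>y * real R ^ m\<rfloor>} \<Longrightarrow> average n F m i \<le> b"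
    and e: "0 \<le> e" "e \<le> 1" "m = n \<or> 2 \<le> e * ((y - x) * real R ^ m)"
  shows "ennreal ((1 - e) * a * (y - x)) \<le> emeasure (cascade_measure n F) J"
    and "emeasure (cascade_measure n F) J \<le> ennreal ((1 + e) * b * (y - x))"
proof -
  let ?\<mu> = "cascade_measure n F"
  let ?h = "real R ^ m"
  let ?X = "\<lfloor>x * ?h\<rfloor>" and ?Y = "\<lfloor>y * ?h\<rfloor>"
  have XY: "?X \<le> ?Y" using J Rm_pos by (intro floor_mono mult_right_mono) (auto intro: less_imp_le)
  have b: "0 < b" using ab(1) ab(2)[of ?X] ab(3)[of ?X] XY by simp
  have main: "ennreal ((1 - e) * a * (y - x)) \<le> emeasure ?\<mu> J \<and>
      emeasure ?\<mu> J \<le> ennreal ((1 + e) * b * (y - x))"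
    using e(3)
  proof
    assume "m = n"
    have dens: "a \<le> density_at n F z" "density_at n F z \<le> b" if "z \<in> J" for z
    proof -
      have "\<lfloor>z * ?h\<rfloor> \<in> {?X..?Y}"
        using that J Rm_pos[of m] by (auto intro!: floor_mono mult_right_mono)
      then show "a \<le> density_at n F z" "density_at n F z \<le> b"
        using ab(2,3)[of "\<lfloor>z * ?h\<rfloor>"] unfolding \<open>m = n\<close> average_top density_at_def by auto
    qed
    have const: "(\<integral>\<^sup>+z. ennreal c * indicator J z \<partial>lborel) = ennreal (c * (y - x))" if "0 < c" for c
      using J that by (subst nn_integral_cmult_indicator) (auto simp: emeasure_lborel_between ennreal_mult)
    have "ennreal (a * (y - x)) \<le> emeasure ?\<mu> J"
      unfolding emeasure_cascade_measure[OF J(4)] const[OF ab(1), symmetric]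
      by (intro nn_integral_mono) (auto simp: dens ennreal_leI split: split_indicator)
    moreover have "(1 - e) * a * (y - x) \<le> 1 * a * (y - x)"
      using e ab J by (intro mult_right_mono) auto
    moreover have "emeasure ?\<mu> J \<le> ennreal (b * (y - x))"
      unfolding emeasure_cascade_measure[OF J(4)] const[OF b, symmetric]
      by (intro nn_integral_mono) (auto simp: dens ennreal_leI split: split_indicator)
    moreover have "1 * b * (y - x) \<le> (1 + e) * b * (y - x)"
      using e b J by (intro mult_right_mono) auto
    ultimately show ?thesis by (auto intro: order_trans ennreal_leI)
  next
    assume "2 \<le> e * ((y - x) * ?h)"
    then have h: "2 / ?h \<le> e * (y - x)" using Rm_pos[of m] by (simp add: pos_divide_le_eq mult_ac)
    have cells: "emeasure ?\<mu> (cell m i) = ennreal (average n F m i / ?h)" for i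
      using F \<open>m \<le> n\<close> by (rule emeasure_cell)
    have "J \<subseteq> {of_int ?X / ?h ..< of_int (?Y + 1) / ?h}"
    proof
      fix z assume "z \<in> J"
      then have "x * ?h \<le> z * ?h" "z * ?h \<le> y * ?h" using J Rm_pos[of m] by (auto intro!: mult_right_mono)
      then have "of_int ?X \<le> z * ?h" "z * ?h < of_int (?Y + 1)" by linarith+
      then show "z \<in> {of_int ?X / ?h ..< of_int (?Y + 1) / ?h}"
        using Rm_pos[of m] by (simp add: pos_divide_le_eq pos_less_divide_eq)
    qed
    then have "emeasure ?\<mu> J \<le> emeasure ?\<mu> {of_int ?X / ?h ..< of_int (?Y + 1) / ?h}"
      by (intro emeasure_mono) auto
    also have "\<dots> = (\<Sum>i\<in>{?X..<?Y + 1}. ennreal (average n F m i / ?h))"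
      using XY by (subst emeasure_cells) (auto simp: cells)
    also have "\<dots> \<le> (\<Sum>i\<in>{?X..<?Y + 1}. ennreal (b / ?h))"
      using Rm_pos[of m] by (intro sum_mono ennreal_leI divide_right_mono ab(3)) auto
    also have "\<dots> = ennreal (of_int (?Y + 1 - ?X) * (b / ?h))"
      using b Rm_pos[of m] XY by (subst sum_ennreal) auto
    also have "\<dots> \<le> ennreal ((1 + e) * b * (y - x))"
    proof (rule ennreal_leI)
      have "of_int (?Y + 1 - ?X) \<le> (y - x) * ?h + 2"
        by (simp only: of_int_add of_int_diff of_int_1 left_diff_distrib) linarith
      then have "of_int (?Y + 1 - ?X) * (b / ?h) \<le> ((y - x) * ?h + 2) * (b / ?h)"
        using b Rm_pos[of m] by (intro mult_right_mono) auto
      also have "\<dots> = b * (y - x) + b * (2 / ?h)" using Rm_pos[of m] by (simp add: field_simps)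
      also have "\<dots> \<le> b * (y - x) + b * (e * (y - x))" using b h by (intro add_left_mono mult_left_mono) auto
      finally show "of_int (?Y + 1 - ?X) * (b / ?h) \<le> (1 + e) * b * (y - x)" by (simp add: algebra_simps)
    qed
    finally have upper: "emeasure ?\<mu> J \<le> ennreal ((1 + e) * b * (y - x))" .
    have low: "(1 - e) * a * (y - x) \<le> of_int (?Y - (?X + 1)) * (a / ?h)"
    proof -
      have count: "(y - x) * ?h - 2 \<le> of_int (?Y - (?X + 1))"
        by (simp only: of_int_add of_int_diff of_int_1 left_diff_distrib) linarith
      have "(1 - e) * a * (y - x) = a * (y - x) - a * (e * (y - x))" by (simp add: algebra_simps)
      also have "\<dots> \<le> a * (y - x) - a * (2 / ?h)" using ab h by (intro diff_left_mono mult_left_mono) auto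
      also have "\<dots> = ((y - x) * ?h - 2) * (a / ?h)" using Rm_pos[of m] by (simp add: field_simps)
      also have "\<dots> \<le> of_int (?Y - (?X + 1)) * (a / ?h)"
        using ab Rm_pos[of m] count by (intro mult_right_mono) auto
      finally show ?thesis .
    qed
    have "ennreal ((1 - e) * a * (y - x)) \<le> emeasure ?\<mu> J"
    proof (cases "?X + 1 \<le> ?Y")
      case False
      then have "of_int (?Y - (?X + 1)) * (a / ?h) \<le> 0"
        using ab Rm_pos[of m] by (intro mult_nonpos_nonneg) auto
      then have "(1 - e) * a * (y - x) \<le> 0" using low by linarith
      then show ?thesis by (simp add: ennreal_neg)
    next
      case True
      have "{of_int (?X + 1) / ?h ..< of_int ?Y / ?h} \<subseteq> {x<..<y}"
      proof
        fix z assume "z \<in> {of_int (?X + 1) / ?h ..< of_int ?Y / ?h}"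
        then have "of_int (?X + 1) \<le> z * ?h" "z * ?h < of_int ?Y"
          using Rm_pos[of m] by (auto simp: pos_divide_le_eq pos_less_divide_eq)
        then have "x * ?h < z * ?h" "z * ?h < y * ?h" by linarith+
        then show "z \<in> {x<..<y}" using Rm_pos[of m] by simp
      qed
      then have sub: "emeasure ?\<mu> {of_int (?X + 1) / ?h ..< of_int ?Y / ?h} \<le> emeasure ?\<mu> J"
        using J by (intro emeasure_mono) auto
      have "ennreal ((1 - e) * a * (y - x)) \<le> ennreal (of_int (?Y - (?X + 1)) * (a / ?h))"
        using low by (rule ennreal_leI)
      also have "\<dots> = (\<Sum>i\<in>{?X + 1..<?Y}. ennreal (a / ?h))"
        using ab Rm_pos[of m] True by (subst sum_ennreal) auto
      also have "\<dots> \<le> (\<Sum>i\<in>{?X + 1..<?Y}. ennreal (average n F m i / ?h))"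
        using Rm_pos[of m] by (intro sum_mono ennreal_leI divide_right_mono ab(2)) auto
      also have "\<dots> = emeasure ?\<mu> {of_int (?X + 1) / ?h ..< of_int ?Y / ?h}"
        using True by (subst emeasure_cells) (auto simp: cells)
      finally show ?thesis using sub by (rule order_trans)
    qed
    with upper show ?thesis by blast
  qed
  then show "ennreal ((1 - e) * a * (y - x)) \<le> emeasure ?\<mu> J"
    and "emeasure ?\<mu> J \<le> ennreal ((1 + e) * b * (y - x))" by auto
qed

end

section \<open>Doubling and the two-weight condition\<close>

lemma enn_powr_ennreal: "0 \<le> x \<Longrightarrow> enn_powr (ennreal x) r = ennreal (x powr r)"
  by (simp add: enn_powr_def)

lemma enn_powr_mono:
  assumes "x \<le> y" "0 \<le> r"
  shows "enn_powr x r \<le> enn_powr y r"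
proof (cases "y = \<infinity>")
  case False
  then have "x \<noteq> \<infinity>" using assms(1) by (metis neq_top_trans infinity_ennreal_def)
  then show ?thesis using False assms
    by (auto simp: enn_powr_def less_top intro!: ennreal_leI powr_mono2 enn2real_mono)
qed (simp add: enn_powr_def)

context cascade
begin

text \<open>The factor by which averages of a function with logarithmic Lipschitz constant \<open>P\<close> may differ among
the cells that meet an interval, at the scale of the interval.\<close>

definition distortion :: "nat \<Rightarrow> nat \<Rightarrow> real \<Rightarrow> real" where
  "distortion n q P = (exp (8 * real n * real q / real R) * ((1 + \<delta>) / (1 - \<delta>))) powr P"

lemma average_comparable:
  assumes "log_lipschitz P F" "1 \<le> t" "close t m i j"
  shows "average n F m i \<le> t powr P * average n F m j"
  unfolding average_def using assms S_pos M_pos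
  by (intro log_lipschitzD[OF log_lipschitz_expect]) (auto simp: close_def)

text \<open>The scale \<open>m\<close> is the same for all functions \<open>F\<close>. This matters for the two-weight condition, where
the averages of \<open>\<sigma>\<close> and \<open>\<omega>\<close> are compared in one and the same cell.\<close>

lemma locally_constant_scale:
  assumes "x < y"
  obtains m where "m \<le> n" "m = n \<or> real q \<le> (y - x) * real R ^ m"
    "\<And>P F i. log_lipschitz P F \<Longrightarrow> i \<in> {\<lfloor>x * real R ^ m\<rfloor>..\<lfloor>y * real R ^ m\<rfloor>} \<Longrightarrow>
      average n F m \<lfloor>x * real R ^ m\<rfloor> / distortion n q P \<le> average n F m i \<and>
      average n F m i \<le> distortion n q P * average n F m \<lfloor>x * real R ^ m\<rfloor>"
proof -
  let ?t = "exp (8 * real n * real q / real R) * ((1 + \<delta>) / (1 - \<delta>))"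
  obtain m where m: "m \<le> n" "m = n \<or> real q \<le> (y - x) * real R ^ m"
    "\<And>i j. i \<in> {\<lfloor>x * real R ^ m\<rfloor>..\<lfloor>y * real R ^ m\<rfloor>} \<Longrightarrow> j \<in> {\<lfloor>x * real R ^ m\<rfloor>..\<lfloor>y * real R ^ m\<rfloor>} \<Longrightarrow>
      close ?t m i j"
    using scale_of_interval[OF assms] by metis
  have "1 * 1 \<le> ?t" using \<delta>_pos \<delta>_le by (intro mult_mono) auto
  then have t: "1 \<le> ?t" by simp
  have x: "\<lfloor>x * real R ^ m\<rfloor> \<in> {\<lfloor>x * real R ^ m\<rfloor>..\<lfloor>y * real R ^ m\<rfloor>}"
    using assms Rm_pos[of m] by (auto intro!: floor_mono mult_right_mono)
  show thesis
  proof (rule that[OF m(1,2)])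
    fix P F i
    assume "log_lipschitz P F" "i \<in> {\<lfloor>x * real R ^ m\<rfloor>..\<lfloor>y * real R ^ m\<rfloor>}"
    moreover have "0 < distortion n q P" unfolding distortion_def by (subst powr_gt_zero) (use t in linarith)
    ultimately show "average n F m \<lfloor>x * real R ^ m\<rfloor> / distortion n q P \<le> average n F m i \<and>
      average n F m i \<le> distortion n q P * average n F m \<lfloor>x * real R ^ m\<rfloor>"
      using average_comparable[of P F ?t m] t m(3) x unfolding distortion_def[symmetric]
      by (simp add: pos_divide_le_eq mult.commute)
  qed
qed

text \<open>
Both halves of an interval are resolved at the scale of the interval itself. The averages over all
cells concerned lie within the distortion of a single one, above and below; hence the square.\<close>

lemma doubling_cascade_measure:
  assumes F: "\<And>s a. 0 < s \<Longrightarrow> 0 < a \<Longrightarrow> 0 < F s a" "log_lipschitz P F"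
    and q: "4 \<le> q" and \<tau>: "0 < \<tau>"
    and small: "(1 + 4 / real q) * (distortion n q P)\<^sup>2 \<le> (1 + \<tau>) * (1 - 4 / real q)"
  shows "doubling \<tau> (cascade_measure n F)"
  unfolding doubling_def
proof (intro ballI)
  fix J assume "J \<in> bounded_intervals"
  then obtain x y where J: "x < y" "{x<..<y} \<subseteq> J" "J \<subseteq> {x..y}" "J \<in> sets borel" "midpt J = (x + y) / 2"
    by (rule bounded_intervalsE)
  define z where "z = (x + y) / 2"
  have z: "x < z" "z < y" "z - x = (y - x) / 2" "y - z = (y - x) / 2"
    using J(1) by (auto simp: z_def field_simps)
  obtain m where m: "m \<le> n" "m = n \<or> real q \<le> (y - x) * real R ^ m"
    "\<And>P F i. log_lipschitz P F \<Longrightarrow> i \<in> {\<lfloor>x * real R ^ m\<rfloor>..\<lfloor>y * real R ^ m\<rfloor>} \<Longrightarrow>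
      average n F m \<lfloor>x * real R ^ m\<rfloor> / distortion n q P \<le> average n F m i \<and>
      average n F m i \<le> distortion n q P * average n F m \<lfloor>x * real R ^ m\<rfloor>"
    using locally_constant_scale[OF J(1)] by metis
  define v where "v = average n F m \<lfloor>x * real R ^ m\<rfloor>"
  define D where "D = distortion n q P"
  have v: "0 < v" unfolding v_def by (rule average_pos) (rule F)
  have D: "0 < D" using \<delta>_pos \<delta>_le by (simp add: D_def distortion_def)
  define l where "l = (y - x) / 2"
  have l: "0 < l" using J(1) by (simp add: l_def)
  define e where "e = 4 / real q"
  have e: "0 \<le> e" "e \<le> 1" using q by (auto simp: e_def)
  have scale: "m = n \<or> 2 \<le> e * (l * real R ^ m)"
  proof (cases "m = n")
    case False
    then have "e * (real q / 2) \<le> e * (l * real R ^ m)"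
      using m(2) e by (intro mult_left_mono) (auto simp: l_def)
    then show ?thesis using q by (simp add: e_def)
  qed simp
  have bounds: "ennreal ((1 - e) * (v / D) * l) \<le> emeasure (cascade_measure n F) K \<and>
      emeasure (cascade_measure n F) K \<le> ennreal ((1 + e) * (D * v) * l)"
    if K: "x \<le> x'" "y' \<le> y" "y' - x' = l" "{x'<..<y'} \<subseteq> K" "K \<subseteq> {x'..y'}" "K \<in> sets borel" for x' y' K
  proof -
    have "x' < y'" using K(3) l by simp
    have "v / D \<le> average n F m i" "average n F m i \<le> D * v"
      if "i \<in> {\<lfloor>x' * real R ^ m\<rfloor>..\<lfloor>y' * real R ^ m\<rfloor>}" for i
    proof -
      have "\<lfloor>x * real R ^ m\<rfloor> \<le> \<lfloor>x' * real R ^ m\<rfloor>" "\<lfloor>y' * real R ^ m\<rfloor> \<le> \<lfloor>y * real R ^ m\<rfloor>"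
        using K(1,2) Rm_pos[of m] by (auto intro!: floor_mono mult_right_mono)
      then have "i \<in> {\<lfloor>x * real R ^ m\<rfloor>..\<lfloor>y * real R ^ m\<rfloor>}" using that by auto
      then show "v / D \<le> average n F m i" "average n F m i \<le> D * v"
        using m(3)[OF F(2)] unfolding v_def D_def by auto
    qed
    moreover have "0 < v / D" using v D by simp
    ultimately show ?thesis
      using emeasure_interval_bounds[OF F(1) m(1) \<open>x' < y'\<close> K(4-6), where a = "v / D" and b = "D * v" and e = e] e scale
      unfolding K(3) by auto
  qed
  have "{x<..<z} \<subseteq> left_half J" "left_half J \<subseteq> {x..z}" "left_half J \<in> sets borel"
    "{z<..<y} \<subseteq> right_half J" "right_half J \<subseteq> {z..y}" "right_half J \<in> sets borel"
  proof -
    show "{x<..<z} \<subseteq> left_half J" "left_half J \<subseteq> {x..z}" "{z<..<y} \<subseteq> right_half J" "right_half J \<subseteq> {z..y}"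
      using J z(1,2) unfolding left_half_def right_half_def J(5) z_def[symmetric] by auto
    have "left_half J = J \<inter> {..<midpt J}" "right_half J = J \<inter> {midpt J..}"
      by (auto simp: left_half_def right_half_def)
    then show "left_half J \<in> sets borel" "right_half J \<in> sets borel" using J(4) by auto
  qed
  then have L: "ennreal ((1 - e) * (v / D) * l) \<le> emeasure (cascade_measure n F) (left_half J)"
      "emeasure (cascade_measure n F) (left_half J) \<le> ennreal ((1 + e) * (D * v) * l)"
    and R: "ennreal ((1 - e) * (v / D) * l) \<le> emeasure (cascade_measure n F) (right_half J)"
      "emeasure (cascade_measure n F) (right_half J) \<le> ennreal ((1 + e) * (D * v) * l)"
    using bounds[of x z "left_half J"] bounds[of z y "right_half J"] z by (auto simp: l_def)
  have "(1 + e) * (D * v) * l = ((1 + e) * D\<^sup>2) * (v / D * l)"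
    using D by (simp add: power2_eq_square)
  also have "\<dots> \<le> ((1 + \<tau>) * (1 - e)) * (v / D * l)"
    using small v D l unfolding e_def[symmetric] D_def[symmetric] by (intro mult_right_mono) auto
  also have "\<dots> = (1 + \<tau>) * ((1 - e) * (v / D) * l)" by simp
  finally have key: "ennreal ((1 + e) * (D * v) * l) \<le> ennreal (1 + \<tau>) * ennreal ((1 - e) * (v / D) * l)"
    using \<tau> e v D l by (subst ennreal_mult[symmetric]) (auto intro!: ennreal_leI)
  have "emeasure (cascade_measure n F) K \<le> ennreal (1 + \<tau>) * emeasure (cascade_measure n F) K'"
    if "emeasure (cascade_measure n F) K \<le> ennreal ((1 + e) * (D * v) * l)"
      "ennreal ((1 - e) * (v / D) * l) \<le> emeasure (cascade_measure n F) K'" for K K'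
    using that(1) key mult_left_mono[OF that(2), of "ennreal (1 + \<tau>)"] by (meson order_trans zero_le)
  then show "emeasure (cascade_measure n F) (left_half J) \<le> ennreal (1 + \<tau>) * emeasure (cascade_measure n F) (right_half J) \<and>
      emeasure (cascade_measure n F) (right_half J) \<le> ennreal (1 + \<tau>) * emeasure (cascade_measure n F) (left_half J)"
    using L R by blast
qed

lemma locally_finite_cascade_measure:
  assumes "\<And>s a. 0 < s \<Longrightarrow> 0 < a \<Longrightarrow> 0 < F s a"
  shows "locally_finite_borel (cascade_measure n F)"
  unfolding locally_finite_borel_def
proof (intro conjI allI)
  fix x :: real
  let ?U = "{of_int (\<lfloor>x\<rfloor> - 1) / real R ^ 0 ..< of_int (\<lfloor>x\<rfloor> + 2) / real R ^ 0}"
  have "emeasure (cascade_measure n F) {x - 1<..<x + 1} \<le> emeasure (cascade_measure n F) ?U"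
    by (intro emeasure_mono) (auto, linarith+)
  also have "\<dots> < \<infinity>"
    by (subst emeasure_cells) (auto simp: emeasure_cell[OF assms])
  finally show "\<exists>U. open U \<and> x \<in> U \<and> emeasure (cascade_measure n F) U < \<infinity>"
    by (intro exI[of _ "{x - 1<..<x + 1}"]) auto
qed simp

text \<open>In a cell of generation \<open>m\<close> with state \<open>(S, M)\<close> the average of \<open>\<sigma>\<close> is \<open>S\<close>, and that of \<open>\<omega>\<close>
is at most \<open>M powr (1 - p) \<le> S powr (1 - p)\<close> because the maximum never decreases. The powers of \<open>S\<close>
cancel in the product, and replacing an interval by a cell costs a factor of at most \<open>2\<close>.\<close>

lemma Ap_cascade_measure:
  assumes p: "1 < p" and P: "1 \<le> P" "p - 1 \<le> P" and q: "4 \<le> q"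
    and small: "(1 + 4 / real q) * distortion n q P \<le> 2"
  shows "Ap_const p (cascade_measure n (\<lambda>s a. s)) (cascade_measure n (\<lambda>s a. a powr (1 - p))) \<le> 2"
  unfolding Ap_const_def
proof (rule SUP_least)
  fix J assume "J \<in> bounded_intervals"
  then obtain x y where J: "x < y" "{x<..<y} \<subseteq> J" "J \<subseteq> {x..y}" "J \<in> sets borel"
    by (rule bounded_intervalsE)
  obtain m where m: "m \<le> n" "m = n \<or> real q \<le> (y - x) * real R ^ m"
    "\<And>P F i. log_lipschitz P F \<Longrightarrow> i \<in> {\<lfloor>x * real R ^ m\<rfloor>..\<lfloor>y * real R ^ m\<rfloor>} \<Longrightarrow>
      average n F m \<lfloor>x * real R ^ m\<rfloor> / distortion n q P \<le> average n F m i \<and>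
      average n F m i \<le> distortion n q P * average n F m \<lfloor>x * real R ^ m\<rfloor>"
    using locally_constant_scale[OF J(1)] by metis
  let ?i = "\<lfloor>x * real R ^ m\<rfloor>"
  define D where "D = distortion n q P"
  have D: "0 < D" using \<delta>_pos \<delta>_le by (simp add: D_def distortion_def)
  define e where "e = 4 / real q"
  have e: "0 \<le> e" "e \<le> 1" using q by (auto simp: e_def)
  have scale: "m = n \<or> 2 \<le> e * ((y - x) * real R ^ m)"
  proof (cases "m = n")
    case False
    then have "e * real q \<le> e * ((y - x) * real R ^ m)"
      using m(2) e by (intro mult_left_mono) auto
    then show ?thesis using q by (simp add: e_def)
  qed simp
  have avg: "emeasure (cascade_measure n F) J / emeasure lborel J \<le> ennreal (2 * average n F m ?i)"
    if F: "\<And>s a. 0 < s \<Longrightarrow> 0 < a \<Longrightarrow> 0 < F s a" "log_lipschitz P F" for F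
  proof -
    have v: "0 < average n F m ?i" by (rule average_pos) (rule F)
    have "emeasure (cascade_measure n F) J \<le> ennreal ((1 + e) * (D * average n F m ?i) * (y - x))"
      using emeasure_interval_bounds(2)[OF F(1) m(1) J, where a = "average n F m ?i / D" and b = "D * average n F m ?i" and e = e]
        m(3)[OF F(2)] v D e scale unfolding D_def[symmetric] by auto
    also have "\<dots> \<le> ennreal (2 * average n F m ?i * (y - x))"
      using mult_right_mono[OF small, of "average n F m ?i * (y - x)"] v J(1)
      unfolding e_def[symmetric] D_def[symmetric] by (intro ennreal_leI) (simp add: mult_ac)
    finally have "emeasure (cascade_measure n F) J / emeasure lborel J
        \<le> ennreal (2 * average n F m ?i * (y - x)) / ennreal (y - x)"
      unfolding emeasure_lborel_between[OF J] by (rule divide_right_mono_ennreal)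
    also have "\<dots> = ennreal (2 * average n F m ?i)"
      using v J(1) by (subst divide_ennreal) auto
    finally show ?thesis .
  qed
  let ?\<sigma> = "cascade_measure n (\<lambda>s a. s)"
  let ?\<omega> = "cascade_measure n (\<lambda>s a. a powr (1 - p))"
  have \<sigma>: "emeasure ?\<sigma> J / emeasure lborel J \<le> ennreal (2 * S m ?i)"
    using avg[of "\<lambda>s a. s"] log_lipschitz_fst[OF P(1)] by (simp add: average_def expect_fst)
  have "average n (\<lambda>s a. a powr (1 - p)) m ?i \<le> M m ?i powr (1 - p)"
    unfolding average_def using p M_pos by (intro expect_antitone_le) (auto intro!: powr_mono2')
  also have "\<dots> \<le> S m ?i powr (1 - p)"
    using p S_pos S_le_M by (intro powr_mono2') auto
  finally have "ennreal (2 * average n (\<lambda>s a. a powr (1 - p)) m ?i) \<le> ennreal (2 * S m ?i powr (1 - p))"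
    by (intro ennreal_leI) simp
  with avg[of "\<lambda>s a. a powr (1 - p)"] log_lipschitz_neg_powr[of p P] p P
  have \<omega>: "emeasure ?\<omega> J / emeasure lborel J \<le> ennreal (2 * S m ?i powr (1 - p))"
    by (auto intro: order_trans)
  have s: "0 < S m ?i" by (rule S_pos)
  have "enn_powr (emeasure ?\<sigma> J / emeasure lborel J) (1 / conj_exponent p) *
      enn_powr (emeasure ?\<omega> J / emeasure lborel J) (1 / p)
    \<le> enn_powr (ennreal (2 * S m ?i)) (1 / conj_exponent p) * enn_powr (ennreal (2 * S m ?i powr (1 - p))) (1 / p)"
    using p \<sigma> \<omega> by (intro mult_mono enn_powr_mono) (auto simp: conj_exponent_def)
  also have "\<dots> = ennreal ((2 * S m ?i) powr (1 / conj_exponent p) * (2 * S m ?i powr (1 - p)) powr (1 / p))"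
    using s by (subst (1 2) enn_powr_ennreal) (simp_all add: ennreal_mult)
  also have "(2 * S m ?i) powr (1 / conj_exponent p) * (2 * S m ?i powr (1 - p)) powr (1 / p) =
      2 powr (1 / conj_exponent p + 1 / p) * S m ?i powr (1 / conj_exponent p + (1 - p) * (1 / p))"
    using s by (simp add: powr_mult powr_powr powr_add)
  also have "\<dots> = 2"
    using p s by (simp add: conj_exponent_def field_simps)
  finally show "enn_powr (emeasure ?\<sigma> J / emeasure lborel J) (1 / conj_exponent p) *
      enn_powr (emeasure ?\<omega> J / emeasure lborel J) (1 / p) \<le> 2" by simp
qed

section \<open>The maximal function\<close>

lemma M_le_of_ancestors:
  assumes "\<And>m. m \<le> n \<Longrightarrow> S m \<lfloor>x * real R ^ m\<rfloor> \<le> L"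
  shows "M n \<lfloor>x * real R ^ n\<rfloor> \<le> L"
  using assms
proof (induction n)
  case (Suc n)
  have "M n (\<lfloor>x * real R ^ Suc n\<rfloor> div int R) \<le> L"
    unfolding floor_parent[symmetric] using Suc by simp
  moreover have "S (Suc n) \<lfloor>x * real R ^ Suc n\<rfloor> \<le> L" by (rule Suc.prems) simp
  ultimately show ?case by (simp del: S.simps power_Suc)
qed auto

text \<open>As \<open>R\<close> is a power of two, the cells inside \<open>{0..<1}\<close> are dyadic intervals, and \<open>S m\<close> is the average
of \<open>\<sigma>\<close> over the cell of generation \<open>m\<close>.\<close>

lemma S_le_dyadic_maximal:
  assumes R: "R = 2 ^ r" and x: "x \<in> {0..<1}" and "m \<le> n"
  shows "ennreal (S m \<lfloor>x * real R ^ m\<rfloor>)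
    \<le> dyadic_maximal (cascade_measure n (\<lambda>s a. s)) (indicator {0..<1}) x"
proof -
  let ?i = "\<lfloor>x * real R ^ m\<rfloor>"
  let ?\<sigma> = "cascade_measure n (\<lambda>s a. s)"
  have i: "0 \<le> ?i" using x Rm_pos[of m] by simp
  have "x * real R ^ m < real R ^ m" using x Rm_pos[of m] by simp
  then have "?i < int R ^ m"
    using floor_less_iff[of "x * real R ^ m" "int R ^ m"] by simp
  then have iR: "?i + 1 \<le> int R ^ m" by simp
  have "cell m ?i = {real (nat ?i) / 2 ^ (r * m)..<(real (nat ?i) + 1) / 2 ^ (r * m)}"
    using i unfolding cell_def by (simp add: R power_mult)
  moreover have "int (nat ?i) < int (2 ^ (r * m))" using i iR by (simp add: R power_mult)
  then have "nat ?i < 2 ^ (r * m)" by linarith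
  ultimately have dy: "cell m ?i \<in> dyadic_unit" unfolding dyadic_unit_def by blast
  have "real_of_int (?i + 1) \<le> real_of_int (int R ^ m)" using iR by (simp only: of_int_le_iff)
  then have "(of_int ?i + 1) / real R ^ m \<le> 1" using Rm_pos[of m] by simp
  moreover have "0 \<le> of_int ?i / real R ^ m" using i by simp
  ultimately have sub: "cell m ?i \<subseteq> {0..<1}" unfolding cell_def by fastforce
  have "(\<integral>\<^sup>+ y\<in>cell m ?i. ennreal \<bar>indicator {0..<1} y :: real\<bar> \<partial>?\<sigma>) = (\<integral>\<^sup>+ y. indicator (cell m ?i) y \<partial>?\<sigma>)"
    using sub by (intro nn_integral_cong) (auto split: split_indicator)
  also have "\<dots> = ennreal (S m ?i / real R ^ m)"
    using \<open>m \<le> n\<close> by (simp add: emeasure_cell average_def expect_fst)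
  finally have "(\<integral>\<^sup>+ y\<in>cell m ?i. ennreal \<bar>indicator {0..<1} y :: real\<bar> \<partial>?\<sigma>) / emeasure lborel (cell m ?i)
      = ennreal (S m ?i / real R ^ m) / ennreal (1 / real R ^ m)" by (simp add: emeasure_lborel_cell)
  also have "\<dots> = ennreal (S m ?i)"
    using Rm_pos[of m] S_pos[of m ?i] by (subst divide_ennreal) auto
  finally show ?thesis unfolding dyadic_maximal_def using dy
    by (intro SUP_upper2[of "cell m ?i"]) (auto simp: mem_cell_iff)
qed

text \<open>Testing on the indicator of \<open>{0..<1}\<close>, whose norm is \<open>1\<close>: the maximal function is at least \<open>M\<close>, and
\<open>M powr p * M powr (1 - p) = M\<close>, so the integral to be bounded is the expected maximum.\<close>

lemma maximal_norm_lower_bound: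
  assumes R: "R = 2 ^ r" and p: "1 < p"
  shows "ennreal (expect n (\<lambda>s a. a) 1 1 powr (1 / p))
    \<le> maximal_norm p (cascade_measure n (\<lambda>s a. s)) (cascade_measure n (\<lambda>s a. a powr (1 - p)))"
proof -
  let ?\<sigma> = "cascade_measure n (\<lambda>s a. s)"
  let ?\<omega> = "cascade_measure n (\<lambda>s a. a powr (1 - p))"
  let ?f = "indicator {0..<1} :: real \<Rightarrow> real"
  have unit: "{0..<1} = cell 0 0" by (simp add: cell_def)
  have "(\<integral>\<^sup>+ x. enn_powr (ennreal \<bar>?f x\<bar>) p \<partial>?\<sigma>) = (\<integral>\<^sup>+ x. indicator {0..<1} x \<partial>?\<sigma>)"
    using p by (intro nn_integral_cong) (auto simp: enn_powr_def split: split_indicator)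
  also have "\<dots> = 1" by (simp add: unit emeasure_cell average_def expect_fst)
  finally have norm_f: "Lp_enorm p ?\<sigma> (\<lambda>x. ennreal \<bar>?f x\<bar>) = 1"
    by (simp add: Lp_enorm_def enn_powr_def)
  then have f: "?f \<in> Lp_space p ?\<sigma>" by (auto simp: Lp_space_def)
  let ?g = "\<lambda>x. M n \<lfloor>x * real R ^ n\<rfloor>"
  have g: "?g = density_at n (\<lambda>s a. a)" by (simp add: density_at_def fun_eq_iff)
  have [measurable]: "?g \<in> borel_measurable borel" unfolding g by measurable
  have E: "0 < expect n (\<lambda>s a. a) 1 1" by (rule expect_pos) auto
  have "ennreal (expect n (\<lambda>s a. a) 1 1) = emeasure (cascade_measure n (\<lambda>s a. a)) (cell 0 0)"
    by (simp add: emeasure_cell average_def)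
  also have "\<dots> = (\<integral>\<^sup>+x. ennreal (?g x) * indicator (cell 0 0) x \<partial>lborel)"
    by (subst emeasure_cascade_measure) (auto simp: density_at_def)
  also have "\<dots> = (\<integral>\<^sup>+x. ennreal (density_at n (\<lambda>s a. a powr (1 - p)) x) *
      (ennreal (?g x powr p) * indicator (cell 0 0) x) \<partial>lborel)"
  proof (intro nn_integral_cong)
    fix x :: real
    have "?g x = ?g x powr (1 - p) * ?g x powr p"
      using M_pos[of n "\<lfloor>x * real R ^ n\<rfloor>"] by (simp add: powr_add[symmetric])
    then have "ennreal (?g x) = ennreal (density_at n (\<lambda>s a. a powr (1 - p)) x) * ennreal (?g x powr p)"
      by (simp add: density_at_def ennreal_mult[symmetric])
    then show "ennreal (?g x) * indicator (cell 0 0) x =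
      ennreal (density_at n (\<lambda>s a. a powr (1 - p)) x) * (ennreal (?g x powr p) * indicator (cell 0 0) x)"
      by (simp add: mult.assoc)
  qed
  also have "\<dots> = (\<integral>\<^sup>+x. ennreal (?g x powr p) * indicator (cell 0 0) x \<partial>?\<omega>)"
    unfolding cascade_measure_def by (rule nn_integral_density[symmetric]) measurable
  also have "\<dots> \<le> (\<integral>\<^sup>+x. enn_powr (dyadic_maximal ?\<sigma> ?f x) p \<partial>?\<omega>)"
  proof (intro nn_integral_mono)
    fix x
    show "ennreal (?g x powr p) * indicator (cell 0 0) x \<le> enn_powr (dyadic_maximal ?\<sigma> ?f x) p"
    proof (cases "x \<in> {0..<1}")
      case True
      have "ennreal (?g x) \<le> dyadic_maximal ?\<sigma> ?f x"
      proof (cases "dyadic_maximal ?\<sigma> ?f x")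
        case (real L)
        have "S m \<lfloor>x * real R ^ m\<rfloor> \<le> L" if "m \<le> n" for m
          using S_le_dyadic_maximal[OF R True that] real by simp
        then show ?thesis unfolding real by (intro ennreal_leI M_le_of_ancestors) auto
      qed simp
      then have "enn_powr (ennreal (?g x)) p \<le> enn_powr (dyadic_maximal ?\<sigma> ?f x) p"
        using p by (intro enn_powr_mono) auto
      then show ?thesis using True M_pos[of n "\<lfloor>x * real R ^ n\<rfloor>"]
        by (simp add: enn_powr_ennreal unit[symmetric])
    qed (simp add: unit[symmetric])
  qed
  finally have "enn_powr (ennreal (expect n (\<lambda>s a. a) 1 1)) (1 / p) \<le> Lp_enorm p ?\<omega> (dyadic_maximal ?\<sigma> ?f)"
    unfolding Lp_enorm_def using p by (intro enn_powr_mono) auto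
  then have low: "ennreal (expect n (\<lambda>s a. a) 1 1 powr (1 / p)) \<le> Lp_enorm p ?\<omega> (dyadic_maximal ?\<sigma> ?f)"
    using E by (simp add: enn_powr_ennreal)
  show ?thesis unfolding maximal_norm_def
  proof (rule Inf_greatest, clarify)
    fix C
    assume "\<forall>f\<in>Lp_space p ?\<sigma>. Lp_enorm p ?\<omega> (dyadic_maximal ?\<sigma> f) \<le> C * Lp_enorm p ?\<sigma> (\<lambda>x. ennreal \<bar>f x\<bar>)"
    then have "Lp_enorm p ?\<omega> (dyadic_maximal ?\<sigma> ?f) \<le> C * Lp_enorm p ?\<sigma> (\<lambda>x. ennreal \<bar>?f x\<bar>)"
      using f by blast
    then show "ennreal (expect n (\<lambda>s a. a) 1 1 powr (1 / p)) \<le> C"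
      using low unfolding norm_f by simp
  qed
qed

end

section \<open>Choice of the parameters\<close>

theorem proposition41:
  fixes p :: real
  assumes "1 < p"
  shows "\<exists>C :: ennreal. C < \<infinity> \<and>
    (\<forall>\<tau> \<Gamma> :: real. 0 < \<tau> \<longrightarrow> \<tau> < 1 / 2 \<longrightarrow> 1 < \<Gamma> \<longrightarrow>
      (\<exists>\<sigma> \<omega> :: real measure.
        locally_finite_borel \<sigma> \<and> locally_finite_borel \<omega> \<and>
        doubling \<tau> \<sigma> \<and> doubling \<tau> \<omega> \<and>
        Ap_const p \<sigma> \<omega> \<le> C \<and>
        maximal_norm p \<sigma> \<omega> > ennreal \<Gamma>))"
proof (intro exI[of _ 2] conjI allI impI)
  show "(2 :: ennreal) < \<infinity>" by simp
next
  fix \<tau> \<Gamma> :: real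
  assume \<tau>: "0 < \<tau>" "\<tau> < 1 / 2" and \<Gamma>: "1 < \<Gamma>"
  define P where "P = max 1 (p - 1)"
  have P: "1 \<le> P" "p - 1 \<le> P" by (auto simp: P_def)
  \<comment> \<open>The order of the choices is essential: \<open>\<delta>\<close> from \<open>\<tau>\<close>, then the number \<open>n\<close> of generations from
    \<open>\<delta>\<close> and \<open>\<Gamma>\<close>, and last \<open>R = 4 ^ r\<close> with \<open>q = sqrt R = 2 ^ r\<close>, so that both \<open>4 / q\<close> and
    \<open>n * q / R = n / q\<close> become small.\<close>
  have "((\<lambda>\<delta>::real. ((1 + \<delta>) / (1 - \<delta>)) powr P) \<longlongrightarrow> ((1 + 0) / (1 - 0)) powr P) (at_right 0)"
    by (intro tendsto_intros) auto
  then have "\<forall>\<^sub>F \<delta> in at_right (0::real). ((1 + \<delta>) / (1 - \<delta>)) powr P < 1 + \<tau> / 32"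
    using \<tau> by (intro order_tendstoD) auto
  moreover have "\<forall>\<^sub>F \<delta> in at_right (0::real). 0 < \<delta> \<and> \<delta> < 1 / 2"
    using eventually_at_right_real[of 0 "1 / 2 :: real"] by simp
  ultimately obtain \<delta> :: real where \<delta>: "((1 + \<delta>) / (1 - \<delta>)) powr P < 1 + \<tau> / 32" "0 < \<delta>" "\<delta> < 1 / 2"
    using eventually_happens'[OF _ eventually_conj] by (smt (verit) trivial_limit_at_right_real)
  \<comment> \<open>\<open>21\<close> comes from \<open>\<kappa> / (1 + \<delta>) \<ge> (\<delta>\<^sup>2 / 14) / (3 / 2)\<close>.\<close>
  obtain n :: nat where n: "\<Gamma> powr p * (21 / \<delta>\<^sup>2) < real n"
    using reals_Archimedean2 by blast
  have "((\<lambda>r::nat. exp (8 * real n * (1 / 2) ^ r) powr P) \<longlonglongrightarrow> exp (8 * real n * 0) powr P)"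
    by (intro tendsto_intros LIMSEQ_power_zero) auto
  then have "\<forall>\<^sub>F r in sequentially. exp (8 * real n * (1 / 2) ^ r) powr P < 1 + \<tau> / 32"
    using \<tau> by (intro order_tendstoD) auto
  moreover have "((\<lambda>r::nat. 4 * (1 / 2 :: real) ^ r) \<longlonglongrightarrow> 4 * 0)"
    by (intro tendsto_intros LIMSEQ_power_zero) auto
  then have "\<forall>\<^sub>F r in sequentially. 4 * (1 / 2 :: real) ^ r < \<tau> / 16"
    by (rule order_tendstoD) (use \<tau> in simp)
  ultimately have "\<forall>\<^sub>F r in sequentially. exp (8 * real n * (1 / 2) ^ r) powr P < 1 + \<tau> / 32 \<and>
      4 * (1 / 2 :: real) ^ r < \<tau> / 16 \<and> 2 \<le> r"
    using eventually_ge_at_top[of 2] by eventually_elim auto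
  then obtain r where r: "exp (8 * real n * (1 / 2) ^ r) powr P < 1 + \<tau> / 32"
      "4 * (1 / 2 :: real) ^ r < \<tau> / 16" "2 \<le> r"
    using eventually_happens' sequentially_bot by blast
  define q :: nat where "q = 2 ^ r"
  have "(2::nat) ^ 2 \<le> 2 ^ r" using r(3) by (intro power_increasing) auto
  then have q: "4 \<le> q" by (simp add: q_def)
  define R :: nat where "R = 2 ^ (2 * r)"
  have Rq: "R = q * q" by (simp add: R_def q_def power_add[symmetric] mult_2)
  have "4 * 4 \<le> q * q" using q by (intro mult_mono) auto
  then interpret cascade R \<delta> using \<delta> by unfold_locales (auto simp: Rq)
  have qr: "1 / real q = (1 / 2) ^ r" by (simp add: q_def power_one_over)
  define e where "e = 4 / real q"
  have e: "0 \<le> e" "e \<le> \<tau> / 16" using r(2) qr by (simp_all add: e_def)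
  define D where "D = distortion n q P"
  have D0: "0 \<le> D" by (simp add: D_def distortion_def)
  have "8 * real n * real q / real R = 8 * real n * (1 / 2) ^ r"
    using q by (simp add: Rq flip: qr)
  then have "D = exp (8 * real n * (1 / 2) ^ r) powr P * ((1 + \<delta>) / (1 - \<delta>)) powr P"
    using \<delta> by (simp add: D_def distortion_def powr_mult del: times_divide_eq_right)
  also have "\<dots> \<le> (1 + \<tau> / 32) * (1 + \<tau> / 32)"
    using r(1) \<delta>(1) \<tau> by (intro mult_mono) auto
  also have "\<dots> \<le> 1 + \<tau> / 8"
    using \<tau> mult_right_mono[of \<tau> "1 / 2" \<tau>] by (simp add: field_simps)
  finally have D: "D \<le> 1 + \<tau> / 8" .
  have "D\<^sup>2 \<le> (1 + \<tau> / 8)\<^sup>2" using D D0 by (intro power_mono) auto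
  also have "\<dots> \<le> 1 + \<tau> / 2"
    using \<tau> mult_right_mono[of \<tau> "1 / 2" \<tau>] by (simp add: field_simps power2_eq_square)
  finally have D2: "D\<^sup>2 \<le> 1 + \<tau> / 2" .
  have "(1 + e) * D\<^sup>2 \<le> (1 + \<tau> / 16) * (1 + \<tau> / 2)"
    using e D2 \<tau> by (intro mult_mono) auto
  also have "\<dots> \<le> (1 + \<tau>) * (1 - \<tau> / 16)"
    using \<tau> mult_right_mono[of \<tau> "1 / 2" \<tau>] by (simp add: field_simps)
  also have "\<dots> \<le> (1 + \<tau>) * (1 - e)" using e \<tau> by (intro mult_left_mono) auto
  finally have small: "(1 + 4 / real q) * (distortion n q P)\<^sup>2 \<le> (1 + \<tau>) * (1 - 4 / real q)"
    unfolding e_def D_def .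
  have "(1 + e) * D \<le> (1 + 1 / 16) * (1 + 1 / 8)"
    using e D D0 \<tau> by (intro mult_mono) auto
  then have small': "(1 + 4 / real q) * distortion n q P \<le> 2"
    unfolding e_def D_def by simp
  let ?\<sigma> = "cascade_measure n (\<lambda>s a. s)"
  let ?\<omega> = "cascade_measure n (\<lambda>s a. a powr (1 - p))"
  have pos: "0 < a powr (1 - p)" if "0 < a" for a :: real using that by simp
  have "\<Gamma> powr p < real n * (\<delta>\<^sup>2 / 21)"
    using n \<delta>(2) by (simp add: field_simps)
  also have "\<dots> \<le> real n * (\<kappa> / (1 + \<delta>))"
  proof (intro mult_left_mono)
    have "\<delta>\<^sup>2 / 21 * (1 + \<delta>) \<le> \<delta>\<^sup>2 / 21 * (3 / 2)" using \<delta> by (intro mult_left_mono) auto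
    also have "\<dots> \<le> \<kappa>" using \<kappa>_lower by simp
    finally show "\<delta>\<^sup>2 / 21 \<le> \<kappa> / (1 + \<delta>)" using \<delta> by (simp add: pos_le_divide_eq)
  qed simp
  also have "\<dots> \<le> expect n (\<lambda>s a. a) 1 1"
    using expect_max_ge[of 1 1 n] by simp
  finally have "(\<Gamma> powr p) powr (1 / p) < expect n (\<lambda>s a. a) 1 1 powr (1 / p)"
    using assms by (intro powr_less_mono2) auto
  then have "ennreal \<Gamma> < ennreal (expect n (\<lambda>s a. a) 1 1 powr (1 / p))"
    using assms \<Gamma> by (simp add: powr_powr ennreal_less_iff)
  also have "\<dots> \<le> maximal_norm p ?\<sigma> ?\<omega>"
    by (rule maximal_norm_lower_bound[OF R_def assms])
  finally have "maximal_norm p ?\<sigma> ?\<omega> > ennreal \<Gamma>" .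
  moreover have "Ap_const p ?\<sigma> ?\<omega> \<le> 2"
    by (rule Ap_cascade_measure[OF assms P q small'])
  moreover have "doubling \<tau> ?\<sigma>"
    by (rule doubling_cascade_measure[OF _ log_lipschitz_fst[OF P(1)] q \<tau>(1) small])
  moreover have "doubling \<tau> ?\<omega>"
    by (rule doubling_cascade_measure[OF _ log_lipschitz_neg_powr[OF _ P(2)] q \<tau>(1) small])
      (use assms in auto)
  ultimately show "\<exists>\<sigma> \<omega>. locally_finite_borel \<sigma> \<and> locally_finite_borel \<omega> \<and>
      doubling \<tau> \<sigma> \<and> doubling \<tau> \<omega> \<and> Ap_const p \<sigma> \<omega> \<le> 2 \<and> maximal_norm p \<sigma> \<omega> > ennreal \<Gamma>"
    using locally_finite_cascade_measure[of "\<lambda>s a. s" n]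
      locally_finite_cascade_measure[of "\<lambda>s a. a powr (1 - p)" n]
    by (intro exI[of _ ?\<sigma>] exI[of _ ?\<omega>]) auto
qed

end
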